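(* For $\alpha > 0$ let $\lambda(\alpha) > 0$ be the unique value of $\lambda$ for which the problem $$[\{u(t)^2 + \sin u(t)\}u'(t)]' + \lambda (u(t) + \sin u(t)) = 0,\quad u(t) > 0 \quad (t \in I := (0,1)), \qquad u(0) = u(1) = 0,$$ has a solution $u$ with $\Vert u\Vert_\infty = \alpha$. Put $A_{2,2} = \int_0^1 \frac{s^2}{\sqrt{1-s^4}}\,ds$, $$C_0 := \int_0^1 \frac{s}{\sqrt{1-s^3}}\,ds, \qquad C_1 := \int_0^1 \frac{1}{\sqrt{1-s^3}}\left(s^2 - \frac{3s(1-s^4)}{8(1-s^3)}\right)ds.$$ (i) As $\alpha \to \infty$, $$\lambda(\alpha) = 8\alpha^2\left\{A_{2,2}^2 - A_{2,2}\sqrt{\pi}\,\alpha^{-3/2}\sin\left(\alpha - \frac{\pi}{4}\right) + o(\alpha^{-3/2})\right\}.$$ (ii) As $\alpha \to 0$, $$\lambda(\alpha) = 3\alpha\left(C_0^2 + 2C_0C_1\alpha + O(\alpha^2)\right).$$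
   Context: Solutions are understood in the class $u \in C^2(I)\cap C(\bar I)$ with $\lambda > 0$. It is known that for every $\alpha > 0$ there is exactly one pair $(u_\alpha,\lambda)$ solving this boundary value problem with $\Vert u_\alpha\Vert_\infty = \alpha$; $\lambda$ is then written $\lambda(\alpha)$, and it is a continuous function of $\alpha>0$. *)

theory Defs
  imports "HOL-Analysis.Analysis" "HOL-Library.Landau_Symbols"
begin

text \<open>
  Continuity on the closed interval and twice continuous differentiability on the open one.
  Nothing is required of the derivatives at the endpoints: the diffusion coefficient
  \<open>u\<^sup>2 + sin u\<close> of the problem below vanishes there, so \<open>u'\<close> is unbounded.
\<close>

definition C2_interior :: "(real \<Rightarrow> real) \<Rightarrow> bool" where
  "C2_interior u \<longleftrightarrow>
     continuous_on {0..1} u \<and>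
     u differentiable_on {0<..<1} \<and>
     deriv u differentiable_on {0<..<1} \<and>
     continuous_on {0<..<1} (deriv (deriv u))"

definition is_solution :: "real \<Rightarrow> (real \<Rightarrow> real) \<Rightarrow> bool" where
  "is_solution lam u \<longleftrightarrow>
     C2_interior u \<and>
     (\<forall>t\<in>{0<..<1}.
        deriv (\<lambda>s. ((u s)\<^sup>2 + sin (u s)) * deriv u s) t + lam * (u t + sin (u t)) = 0) \<and>
     (\<forall>t\<in>{0<..<1}. u t > 0) \<and>
     u 0 = 0 \<and> u 1 = 0"

definition sup_norm :: "(real \<Rightarrow> real) \<Rightarrow> real" where
  "sup_norm u = (SUP t\<in>{0..1}. \<bar>u t\<bar>)"

text \<open>
  For every \<open>\<alpha> > 0\<close> there is exactly one \<open>lam > 0\<close> with the property below.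
\<close>

definition bif_lambda :: "real \<Rightarrow> real" where
  "bif_lambda \<alpha> = (THE lam. lam > 0 \<and> (\<exists>u. is_solution lam u \<and> sup_norm u = \<alpha>))"

text \<open>
  In the next three integrals the integrand is singular at \<open>s = 1\<close>, where division by zero
  gives it the value \<open>0\<close>; each integrand is absolutely integrable on the unit interval.
\<close>

definition A22 :: real where
  "A22 = integral {0..1} (\<lambda>s. s\<^sup>2 / sqrt (1 - s ^ 4))"

definition C0 :: real where
  "C0 = integral {0..1} (\<lambda>s. s / sqrt (1 - s ^ 3))"

definition C1 :: real where
  "C1 = integral {0..1}
     (\<lambda>s. 1 / sqrt (1 - s ^ 3) * (s\<^sup>2 - 3 * s * (1 - s ^ 4) / (8 * (1 - s ^ 3))))"

end

theory Submission
  imports Defs "HOL-Probability.Probability" "HOL-Real_Asymp.Real_Asymp"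
begin

text \<open>
  Write \<open>D u = u\<^sup>2 + sin u\<close>, \<open>g u = u + sin u\<close>, and let \<open>G\<close> be the primitive of \<open>D g\<close> that vanishes
  at \<open>0\<close>. Along a solution the flux \<open>p = D(u) u'\<close> satisfies \<open>p' = - lam g(u) < 0\<close>, and multiplying
  the equation by \<open>p\<close> shows that \<open>p\<^sup>2 / 2 + lam G(u)\<close> is constant; at the maximum \<open>\<alpha>\<close> of \<open>u\<close> the flux
  vanishes, so the constant is \<open>lam G(\<alpha>)\<close>. Hence \<open>u\<close> rises to \<open>\<alpha>\<close> and then falls, and separating
  variables on each branch shows that either branch takes the time \<open>T(\<alpha>) / sqrt (2 lam)\<close>, where
  \<open>T(\<alpha>)\<close> is the integral of \<open>D u / sqrt (G \<alpha> - G u)\<close> over \<open>{0..\<alpha>}\<close>. The two times add up to \<open>1\<close>, so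
  \<open>lam = 2 T(\<alpha>)\<^sup>2\<close> (\<open>solution_lambda\<close>). A solution is obtained by inverting the same quadrature in
  a parameter in which it is regular at the maximum (\<open>solution_exists\<close>), and so
  \<open>bif_lambda \<alpha> = 2 T(\<alpha>)\<^sup>2\<close>.

  It remains to expand \<open>T\<close>. After the substitution \<open>u = \<alpha> s\<close>, the difference \<open>G \<alpha> - G (\<alpha> s)\<close> is a
  constant times \<open>d + e + \<rho>\<close>. Here \<open>d\<close> is \<open>1 - s\<^sup>3\<close> when \<open>\<alpha>\<close> is small and \<open>1 - s\<^sup>4\<close> when \<open>\<alpha>\<close> is large, and
  relative to \<open>d\<close> the terms \<open>e\<close> and \<open>\<rho>\<close> have sizes \<open>\<epsilon>\<close> and \<open>\<epsilon>\<^sup>2\<close>, with \<open>\<epsilon> = \<alpha>\<close> and \<open>\<epsilon> = 1 / \<alpha>\<close> respectively.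
  Since \<open>d \<ge> 1 - s\<close>, the first-order expansion of the inverse square root leaves an error of at most
  a constant times \<open>\<epsilon>\<^sup>2 / sqrt (1 - s)\<close>, which is integrable (\<open>perturbed_integral\<close>). For small \<open>\<alpha>\<close> the
  first-order term is \<open>\<alpha> C1\<close>, and the second claim follows.

  For large \<open>\<alpha>\<close> one has \<open>e = 4 \<alpha>\<^sup>-\<^sup>2 (cos (\<alpha> s) - cos \<alpha>)\<close>, and the first-order term is the integral of
  \<open>- 2 \<alpha>\<^sup>-\<^sup>2 s\<^sup>2 (cos (\<alpha> s) - cos \<alpha>) / (1 - s\<^sup>4)\<^sup>3\<^sup>/\<^sup>2\<close>. Only the singularity at \<open>s = 1\<close> matters: up to a
  bounded error in the integral, the kernel \<open>s\<^sup>2 / (1 - s\<^sup>4)\<^sup>3\<^sup>/\<^sup>2\<close> may be replaced by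
  \<open>(1 - s)\<^sup>-\<^sup>3\<^sup>/\<^sup>2 / 8\<close> (\<open>quartic_kernel_singularity\<close>). The substitution \<open>x = \<alpha> (1 - s)\<close> then produces
  \<open>sqrt \<alpha>\<close> times the integral of \<open>(cos (\<alpha> - x) - cos \<alpha>) / x\<^sup>3\<^sup>/\<^sup>2\<close> over the positive half-line, which is
  \<open>2 sqrt \<pi> sin (\<alpha> - \<pi>/4)\<close> because \<open>sin x / x\<^sup>3\<^sup>/\<^sup>2\<close> and \<open>(1 - cos x) / x\<^sup>3\<^sup>/\<^sup>2\<close> both have the integral
  \<open>sqrt (2 \<pi>)\<close> (\<open>oscillatory_integral\<close>). All errors together are \<open>O(\<alpha>\<^sup>-\<^sup>2)\<close>, which is smaller than
  \<open>\<alpha>\<^sup>-\<^sup>3\<^sup>/\<^sup>2\<close>.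
\<close>

section \<open>The coefficients and their potential\<close>

definition diffusion :: "real \<Rightarrow> real" where
  "diffusion u = u\<^sup>2 + sin u"

definition reaction :: "real \<Rightarrow> real" where
  "reaction u = u + sin u"

text \<open>
  The primitive of \<open>diffusion u * reaction u\<close> that vanishes at \<open>0\<close>. The four groups of terms are the
  primitives of \<open>u\<^sup>3\<close>, \<open>u\<^sup>2 sin u\<close>, \<open>u sin u\<close> and \<open>(sin u)\<^sup>2\<close>.
\<close>

definition potential :: "real \<Rightarrow> real" where
  "potential u = u ^ 4 / 4 + ((2 - u\<^sup>2) * cos u + 2 * u * sin u - 2)
     + (sin u - u * cos u) + (u / 2 - sin u * cos u / 2)"

text \<open>
  Up to the factor \<open>1 / sqrt (2 lam)\<close>, the time that a solution needs to climb from \<open>0\<close> to its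
  maximum \<open>\<alpha>\<close>.
\<close>

definition time_map :: "real \<Rightarrow> real" where
  "time_map \<alpha> = integral {0..\<alpha>} (\<lambda>u. diffusion u / sqrt (potential \<alpha> - potential u))"

lemma diffusion_pos:
  assumes "u > 0" shows "diffusion u > 0"
proof (cases "u < pi")
  case True
  then show ?thesis using assms sin_gt_zero[of u] by (simp add: diffusion_def add_pos_pos)
next
  case False
  then have "u > 1" using pi_gt3 by linarith
  then have "u\<^sup>2 > 1" by (simp add: one_less_power)
  then show ?thesis using sin_ge_minus_one[of u] unfolding diffusion_def by linarith
qed

text \<open>
  Where the sine is negative, \<open>u\<close> exceeds \<open>pi\<close> and hence \<open>2\<close>, so that \<open>u / 2\<close> absorbs it.
\<close>

lemma reaction_ge_half:
  assumes "u \<ge> 0" shows "reaction u \<ge> u / 2"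
proof (cases "u < pi")
  case True
  then show ?thesis using assms sin_ge_zero[of u] by (simp add: reaction_def)
next
  case False
  then have "u > 2" using pi_gt3 by linarith
  then show ?thesis using sin_ge_minus_one[of u] unfolding reaction_def by linarith
qed

lemma reaction_pos: "u > 0 \<Longrightarrow> reaction u > 0"
  using reaction_ge_half[of u] by linarith

lemma potential_0 [simp]: "potential 0 = 0"
  by (simp add: potential_def)

lemma has_derivative_potential:
  "(potential has_real_derivative diffusion u * reaction u) (at u)"
proof -
  have "(cos u)\<^sup>2 = 1 - (sin u)\<^sup>2"
    by (simp add: cos_squared_eq)
  then have *: "cos u * cos u = 1 - sin u * sin u" by (simp add: power2_eq_square)
  show ?thesis
    unfolding potential_def[abs_def] diffusion_def reaction_def
    by (rule derivative_eq_intros refl | (simp add: field_simps power2_eq_square power3_eq_cube *; fail))+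
qed

lemma continuous_on_potential: "continuous_on A potential"
  unfolding potential_def[abs_def] by (intro continuous_intros) auto

lemma potential_strict_mono:
  assumes "0 \<le> u" "u < v" shows "potential u < potential v"
proof (rule DERIV_pos_imp_increasing_open[OF assms(2)])
  fix x assume "u < x" "x < v"
  then have "diffusion x * reaction x > 0"
    using assms diffusion_pos[of x] reaction_pos[of x] by simp
  then show "\<exists>y. (potential has_real_derivative y) (at x) \<and> 0 < y"
    using has_derivative_potential by blast
qed (rule continuous_on_potential)

section \<open>Every solution satisfies the time-map relation\<close>

text \<open>
  The inverse is only differentiable on the open interval, as the derivative of \<open>f\<close> may vanish or fail
  to exist at the end points; its continuity on the closed interval is what makes the fundamental
  theorem of calculus applicable to improper integrals below.
\<close>

lemma increasing_differentiable_inverse: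
  fixes f :: "real \<Rightarrow> real"
  assumes ab: "a < b" and cont: "continuous_on {a..b} f"
    and der: "\<And>x. x \<in> {a<..<b} \<Longrightarrow> (f has_real_derivative f' x) (at x)"
    and pos: "\<And>x. x \<in> {a<..<b} \<Longrightarrow> f' x > 0"
  obtains h where "f a < f b" "continuous_on {f a..f b} h"
    "\<And>x. x \<in> {a..b} \<Longrightarrow> h (f x) = x"
    "\<And>y. y \<in> {f a..f b} \<Longrightarrow> h y \<in> {a..b} \<and> f (h y) = y"
    "\<And>y. y \<in> {f a<..<f b} \<Longrightarrow> h y \<in> {a<..<b}"
    "\<And>y. y \<in> {f a<..<f b} \<Longrightarrow> (h has_real_derivative inverse (f' (h y))) (at y)"
proof -
  have mono: "f x < f y" if "a \<le> x" "x < y" "y \<le> b" for x y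
  proof (rule DERIV_pos_imp_increasing_open[OF that(2)])
    show "continuous_on {x..y} f" using cont that by (auto intro: continuous_on_subset)
    fix t assume "x < t" "t < y"
    then have "t \<in> {a<..<b}" using that by auto
    then show "\<exists>z. (f has_real_derivative z) (at t) \<and> 0 < z"
      using der pos by blast
  qed
  have inj: "inj_on f {a..b}"
    by (rule inj_onI) (metis atLeastAtMost_iff linorder_neqE_linordered_idom mono less_irrefl)
  have fab: "f a < f b" using mono[of a b] ab by simp
  have img: "f ` {a..b} = {f a..f b}"
  proof
    show "f ` {a..b} \<subseteq> {f a..f b}"
    proof clarify
      fix t assume "t \<in> {a..b}"
      then show "f t \<in> {f a..f b}"
        using mono[of a t] mono[of t b] by (cases "t = a"; cases "t = b") auto
    qed
    show "{f a..f b} \<subseteq> f ` {a..b}"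
      using IVT'[of f a _ b] ab cont by fastforce
  qed
  define h where "h = the_inv_into {a..b} f"
  have fh: "f (h w) = w" if "w \<in> {f a..f b}" for w
    using f_the_inv_into_f[OF inj] that img unfolding h_def by auto
  have hf: "h (f t) = t" if "t \<in> {a..b}" for t
    unfolding h_def using the_inv_into_f_f[OF inj that] .
  have hin: "h w \<in> {a..b}" if "w \<in> {f a..f b}" for w
    unfolding h_def using the_inv_into_into[OF inj _ subset_refl] that img by auto
  have conth: "continuous_on {f a..f b} h"
    using continuous_on_inv[OF cont compact_Icc, of h] hf img by auto
  have hin': "h w \<in> {a<..<b}" if w: "w \<in> {f a<..<f b}" for w
  proof -
    have "h w \<noteq> a" "h w \<noteq> b" using fh[of w] w by auto
    then show ?thesis using hin[of w] w by auto
  qed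
  have "(h has_real_derivative inverse (f' (h w))) (at w)" if w: "w \<in> {f a<..<f b}" for w
  proof (rule DERIV_inverse_function)
    show "(f has_real_derivative f' (h w)) (at (h w))" using der[OF hin'[OF w]] .
    show "f' (h w) \<noteq> 0" by (rule less_imp_neq[OF pos[OF hin'[OF w]], symmetric])
    show "f a < w" "w < f b" using w by auto
    show "f (h y) = y" if "f a < y" "y < f b" for y using fh that by auto
    show "isCont h w" using conth w
      by (metis atLeastAtMost_iff continuous_on_interior greaterThanLessThan_iff interior_atLeastAtMost_real)
  qed
  then show ?thesis using that[of h] fab conth hf fh hin hin' by blast
qed

text \<open>
  Separation of variables on one monotone branch: up to the factor \<open>sqrt c\<close>, the integrand is the
  derivative of the inverse function of \<open>v\<close>, so its integral is \<open>sqrt c\<close> times the length of the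
  interval that \<open>v\<close> needs to rise from \<open>0\<close> to \<open>\<alpha>\<close>. Integrability comes for free.
\<close>

lemma time_map_has_integral_half:
  assumes b: "b > 0" and c: "c > 0"
    and cont: "continuous_on {0..b} v" and v0: "v 0 = 0" and vb: "v b = \<alpha>"
    and pos: "\<And>t. t \<in> {0<..<b} \<Longrightarrow> 0 < v t \<and> v t < \<alpha>"
    and der: "\<And>t. t \<in> {0<..<b} \<Longrightarrow>
      (v has_real_derivative sqrt (c * (potential \<alpha> - potential (v t))) / diffusion (v t)) (at t)"
  shows "((\<lambda>w. diffusion w / sqrt (potential \<alpha> - potential w)) has_integral sqrt c * b) {0..\<alpha>}"
proof -
  let ?v' = "\<lambda>t. sqrt (c * (potential \<alpha> - potential (v t))) / diffusion (v t)"
  have v'pos: "?v' t > 0" if "t \<in> {0<..<b}" for t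
    using pos[OF that] potential_strict_mono[of "v t" \<alpha>] diffusion_pos[of "v t"] c by simp
  obtain k where \<alpha>pos: "0 < \<alpha>" and contk: "continuous_on {0..\<alpha>} k"
    and kv: "\<And>t. t \<in> {0..b} \<Longrightarrow> k (v t) = t"
    and vk: "\<And>w. w \<in> {0..\<alpha>} \<Longrightarrow> k w \<in> {0..b} \<and> v (k w) = w"
    and dk: "\<And>w. w \<in> {0<..<\<alpha>} \<Longrightarrow> (k has_real_derivative inverse (?v' (k w))) (at w)"
    using increasing_differentiable_inverse[OF b cont der v'pos] v0 vb by metis
  have "((\<lambda>w. diffusion w / sqrt (potential \<alpha> - potential w)) has_integral
          (sqrt c * k \<alpha> - sqrt c * k 0)) {0..\<alpha>}"
  proof (rule fundamental_theorem_of_calculus_interior)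
    show "0 \<le> \<alpha>" using \<alpha>pos by simp
    show "continuous_on {0..\<alpha>} (\<lambda>w. sqrt c * k w)"
      by (intro continuous_intros contk)
    fix w assume w: "w \<in> {0<..<\<alpha>}"
    have "((\<lambda>w. sqrt c * k w) has_real_derivative sqrt c * inverse (?v' (k w))) (at w)"
      by (rule DERIV_cmult[OF dk[OF w]])
    moreover have "sqrt c * inverse (?v' (k w)) = diffusion w / sqrt (potential \<alpha> - potential w)"
      using vk[of w] w c diffusion_pos[of w] potential_strict_mono[of w \<alpha>]
      by (simp add: real_sqrt_mult divide_simps)
    ultimately show "((\<lambda>w. sqrt c * k w) has_vector_derivative
        diffusion w / sqrt (potential \<alpha> - potential w)) (at w)"
      by (simp add: has_real_derivative_iff_has_vector_derivative)
  qed
  moreover have "k \<alpha> = b" "k 0 = 0" using kv[of b] kv[of 0] v0 vb b by auto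
  ultimately show ?thesis by simp
qed

lemma sup_norm_attained:
  assumes cont: "continuous_on {0..1} u" and nonneg: "\<And>t. t \<in> {0..1} \<Longrightarrow> u t \<ge> 0"
  obtains t0 where "t0 \<in> {0..1}" "u t0 = sup_norm u" "\<And>t. t \<in> {0..1} \<Longrightarrow> u t \<le> sup_norm u"
proof -
  obtain t0 where t0: "t0 \<in> {0..1}" "\<And>t. t \<in> {0..1} \<Longrightarrow> u t \<le> u t0"
    using continuous_attains_sup[of "{0..1::real}" u] cont by auto
  have "sup_norm u = (SUP t\<in>{0..1}. u t)"
    unfolding sup_norm_def using nonneg by (intro SUP_cong) auto
  also have "\<dots> = u t0"
    using t0 by (intro cSup_eq_maximum) auto
  finally show ?thesis using t0 that by auto
qed

text \<open>
  The branch before the maximum and the reflected branch after it solve the same first-order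
  equation, so both take the same time; as their lengths are \<open>t0\<close> and \<open>1 - t0\<close>, the time map determines
  \<open>lam\<close>.
\<close>

lemma solution_lambda:
  assumes sol: "is_solution lam u" and lam: "lam > 0" and nrm: "sup_norm u = \<alpha>"
  shows "lam = 2 * (time_map \<alpha>)\<^sup>2"
    and "(\<lambda>w. diffusion w / sqrt (potential \<alpha> - potential w)) integrable_on {0..\<alpha>}"
proof -
  have cont: "continuous_on {0..1} u"
    and du: "\<And>t. t \<in> {0<..<1} \<Longrightarrow> (u has_real_derivative deriv u t) (at t)"
    and ddu: "\<And>t. t \<in> {0<..<1} \<Longrightarrow> (deriv u has_real_derivative deriv (deriv u) t) (at t)"
    using sol unfolding is_solution_def C2_interior_def
    by (auto simp: differentiable_on_eq_differentiable_at
        DERIV_deriv_iff_real_differentiable)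
  have eq: "\<And>t. t \<in> {0<..<1} \<Longrightarrow> deriv (\<lambda>s. diffusion (u s) * deriv u s) t = - lam * reaction (u t)"
    and pos: "\<And>t. t \<in> {0<..<1} \<Longrightarrow> u t > 0" and u0: "u 0 = 0" and u1: "u 1 = 0"
    using sol unfolding is_solution_def by (force simp: diffusion_def reaction_def)+
  have nonneg: "u t \<ge> 0" if "t \<in> {0..1}" for t
    using pos[of t] u0 u1 that by (cases "t = 0"; cases "t = 1") auto
  obtain t0 where t0: "t0 \<in> {0..1}" "u t0 = \<alpha>" and le: "\<And>t. t \<in> {0..1} \<Longrightarrow> u t \<le> \<alpha>"
    using sup_norm_attained[OF cont nonneg] nrm by metis
  have \<alpha>pos: "\<alpha> > 0" using pos[of "1/2"] le[of "1/2"] by simp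
  have t0': "t0 \<in> {0<..<1}" using t0 u0 u1 \<alpha>pos by (cases "t0 = 0"; cases "t0 = 1") auto
  have crit: "deriv u t0 = 0"
  proof (rule DERIV_local_max[OF du[OF t0']])
    show "0 < min t0 (1 - t0)" using t0' by auto
    show "\<forall>y. \<bar>t0 - y\<bar> < min t0 (1 - t0) \<longrightarrow> u y \<le> u t0"
    proof (intro allI impI)
      fix y assume "\<bar>t0 - y\<bar> < min t0 (1 - t0)"
      then have "y \<in> {0..1}" by auto
      then show "u y \<le> u t0" using le t0(2) by simp
    qed
  qed
  define p where "p t = diffusion (u t) * deriv u t" for t
  have dp: "(p has_real_derivative - lam * reaction (u t)) (at t)" if t: "t \<in> {0<..<1}" for t
  proof -
    have "(p has_real_derivative
       (2 * u t * deriv u t + cos (u t) * deriv u t) * deriv u t + deriv (deriv u) t * diffusion (u t)) (at t)"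
      unfolding p_def[abs_def] diffusion_def
      by (rule derivative_eq_intros du[OF t] ddu[OF t] refl)+ simp
    then have "(p has_real_derivative deriv p t) (at t)"
      by (simp add: DERIV_imp_deriv)
    then show ?thesis using eq[OF t] unfolding p_def[abs_def] by simp
  qed
  \<comment> \<open>The flux is strictly decreasing and vanishes at \<open>t0\<close>, which fixes the sign of \<open>u'\<close> on either side.\<close>
  have pmono: "p y < p x" if "0 < x" "x < y" "y < 1" for x y
  proof (rule DERIV_neg_imp_decreasing[OF that(2)])
    fix t assume "x \<le> t" "t \<le> y"
    then have t: "t \<in> {0<..<1}" using that by auto
    then show "\<exists>z. (p has_real_derivative z) (at t) \<and> z < 0"
      using dp[OF t] reaction_pos[OF pos[OF t]] lam by (intro exI[of _ "- lam * reaction (u t)"]) auto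
  qed
  have p0: "p t0 = 0" by (simp add: p_def crit)
  \<comment> \<open>Conservation of energy, evaluated at the maximum.\<close>
  have energy: "(p t)\<^sup>2 = 2 * lam * (potential \<alpha> - potential (u t))" if t: "t \<in> {0<..<1}" for t
  proof -
    let ?E = "\<lambda>t. (p t)\<^sup>2 + 2 * lam * potential (u t)"
    have "?E t = ?E t0"
    proof (rule DERIV_isconst3[OF _ t t0'])
      fix x :: real assume x: "x \<in> {0<..<1}"
      have "((\<lambda>t. potential (u t)) has_real_derivative diffusion (u x) * reaction (u x) * deriv u x) (at x)"
        by (rule DERIV_chain2[OF has_derivative_potential du[OF x]])
      then have "(?E has_real_derivative
          2 * p x * (- lam * reaction (u x)) + 2 * lam * (diffusion (u x) * reaction (u x) * deriv u x)) (at x)"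
        by (auto intro!: derivative_eq_intros dp[OF x])
      then show "(?E has_real_derivative 0) (at x)" by (simp add: p_def algebra_simps)
    qed simp
    then show ?thesis using p0 t0(2) by (simp add: algebra_simps)
  qed
  have lt: "u t < \<alpha>" if t: "t \<in> {0<..<1}" "t \<noteq> t0" for t
  proof -
    have "p t \<noteq> 0" using pmono[of t t0] pmono[of t0 t] t t0' p0 by (cases "t < t0") auto
    then have "u t \<noteq> \<alpha>" using energy[OF t(1)] by auto
    then show ?thesis using le[of t] t by auto
  qed
  have left: "((\<lambda>w. diffusion w / sqrt (potential \<alpha> - potential w)) has_integral sqrt (2 * lam) * t0) {0..\<alpha>}"
  proof (rule time_map_has_integral_half)
    show "continuous_on {0..t0} u" using cont t0' by (auto intro: continuous_on_subset)
    fix t assume t: "t \<in> {0<..<t0}"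
    then have t': "t \<in> {0<..<1}" using t0' by auto
    show "0 < u t \<and> u t < \<alpha>" using pos[OF t'] lt[OF t'] t by auto
    have "p t > 0" using pmono[of t t0] t t0' p0 by auto
    then have "p t = sqrt (2 * lam * (potential \<alpha> - potential (u t)))"
      using energy[OF t'] by (simp add: real_sqrt_unique)
    then have "deriv u t = sqrt (2 * lam * (potential \<alpha> - potential (u t))) / diffusion (u t)"
      using diffusion_pos[OF pos[OF t']] by (simp add: p_def eq_divide_eq mult.commute)
    then show "(u has_real_derivative sqrt (2 * lam * (potential \<alpha> - potential (u t))) / diffusion (u t)) (at t)"
      using du[OF t'] by simp
  qed (use t0 t0' u0 lam in auto)
  have right: "((\<lambda>w. diffusion w / sqrt (potential \<alpha> - potential w)) has_integral sqrt (2 * lam) * (1 - t0)) {0..\<alpha>}"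
  proof (rule time_map_has_integral_half[where v = "\<lambda>t. u (1 - t)"])
    show "continuous_on {0..1 - t0} (\<lambda>t. u (1 - t))"
      using t0' by (intro continuous_on_compose2[OF cont] continuous_intros) auto
    fix t assume t: "t \<in> {0<..<1 - t0}"
    then have t': "1 - t \<in> {0<..<1}" using t0' by auto
    show "0 < u (1 - t) \<and> u (1 - t) < \<alpha>" using pos[OF t'] lt[OF t'] t by auto
    have "p (1 - t) < 0" using pmono[of t0 "1 - t"] t t0' p0 by auto
    then have "- p (1 - t) = sqrt (2 * lam * (potential \<alpha> - potential (u (1 - t))))"
      using energy[OF t'] by (intro real_sqrt_unique[symmetric]) auto
    then have "deriv u (1 - t) * (- 1) = sqrt (2 * lam * (potential \<alpha> - potential (u (1 - t)))) / diffusion (u (1 - t))"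
      using diffusion_pos[OF pos[OF t']] by (simp add: p_def eq_divide_eq mult.commute)
    moreover have "((\<lambda>t. u (1 - t)) has_real_derivative deriv u (1 - t) * (- 1)) (at t)"
      by (rule DERIV_chain2[of u "deriv u (1 - t)" "\<lambda>t. 1 - t" t "- 1", OF du[OF t']]) (auto intro!: derivative_eq_intros)
    ultimately show "((\<lambda>t. u (1 - t)) has_real_derivative
        sqrt (2 * lam * (potential \<alpha> - potential (u (1 - t)))) / diffusion (u (1 - t))) (at t)"
      by simp
  qed (use t0 t0' u1 lam in auto)
  have "time_map \<alpha> = sqrt (2 * lam) * t0" "time_map \<alpha> = sqrt (2 * lam) * (1 - t0)"
    unfolding time_map_def by (rule integral_unique[OF left], rule integral_unique[OF right])
  then have "2 * time_map \<alpha> = sqrt (2 * lam) * t0 + sqrt (2 * lam) * (1 - t0)" by linarith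
  then have "2 * time_map \<alpha> = sqrt (2 * lam)" by (simp add: algebra_simps)
  then have "(2 * time_map \<alpha>)\<^sup>2 = 2 * lam" using lam by simp
  then show "lam = 2 * (time_map \<alpha>)\<^sup>2" by (simp add: power2_eq_square)
  show "(\<lambda>w. diffusion w / sqrt (potential \<alpha> - potential w)) integrable_on {0..\<alpha>}"
    using left by blast
qed


section \<open>Existence of solutions\<close>

lemma integrable_on_Icc_dominated:
  fixes f g :: "real \<Rightarrow> real"
  assumes cont: "continuous_on {a<..<b} f" and g: "g integrable_on {a..b}"
    and le: "\<And>x. x \<in> {a<..<b} \<Longrightarrow> \<bar>f x\<bar> \<le> g x"
  shows "f integrable_on {a..b}"
proof -
  have "f integrable_on {a<..<b}"
  proof (rule measurable_bounded_by_integrable_imp_integrable[where g = g])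
    show "f \<in> borel_measurable (lebesgue_on {a<..<b})"
      by (rule continuous_imp_measurable_on_sets_lebesgue[OF cont]) simp
    show "g integrable_on {a<..<b}" using g by (simp add: integrable_on_open_interval_real)
  qed (use le in auto)
  then show ?thesis by (simp add: integrable_on_open_interval_real)
qed

text \<open>
  A crude bound (the potential is of cubic order at \<open>0\<close>) that suffices to make the quadrature in the
  existence proof converge.
\<close>

lemma potential_le_square:
  assumes "0 \<le> u" "u \<le> \<alpha>" shows "potential u \<le> \<alpha> * (\<alpha> + 1) * u\<^sup>2"
proof -
  have "\<alpha> * (\<alpha> + 1) * 0\<^sup>2 - potential 0 \<le> \<alpha> * (\<alpha> + 1) * u\<^sup>2 - potential u"
  proof (rule DERIV_nonneg_imp_nondecreasing[OF assms(1)])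
    fix x assume x: "0 \<le> x" "x \<le> u"
    have sx: "sin x \<le> x" using x by (simp add: sin_x_le_x)
    have "diffusion x \<le> (\<alpha> + 1) * x"
      unfolding diffusion_def power2_eq_square using sx x assms mult_right_mono[of x \<alpha> x]
      by (simp add: distrib_right)
    moreover have "reaction x \<le> 2 * \<alpha>" using sx x assms unfolding reaction_def by linarith
    moreover have "diffusion x \<ge> 0" using diffusion_pos[of x] x by (cases "x = 0") (auto simp: diffusion_def)
    moreover have "reaction x \<ge> 0" using reaction_ge_half[of x] x by linarith
    ultimately have "diffusion x * reaction x \<le> ((\<alpha> + 1) * x) * (2 * \<alpha>)"
      using x assms by (intro mult_mono) auto
    then show "\<exists>y. ((\<lambda>u. \<alpha> * (\<alpha> + 1) * u\<^sup>2 - potential u) has_real_derivative y) (at x) \<and> 0 \<le> y"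
      by (intro exI[of _ "\<alpha> * (\<alpha> + 1) * (2 * x) - diffusion x * reaction x"])
         (auto intro!: derivative_eq_intros has_derivative_potential simp: algebra_simps)
  qed
  then show ?thesis by simp
qed

text \<open>
  The quadrature \<open>dt = D du / sqrt (2 lam (G \<alpha> - G u))\<close> is singular at the maximum of \<open>u\<close>. The
  parameter \<open>\<theta>\<close> running from \<open>-1\<close> to \<open>1\<close> with \<open>G u = G \<alpha> (1 - \<theta>\<^sup>2)\<close>, a negative multiple of the flux,
  removes this singularity: \<open>u = U \<theta>\<close> is differentiable through \<open>\<theta> = 0\<close>, and in a rescaled time of
  total length \<open>S\<close> the motion becomes \<open>\<theta>' = g (U \<theta>)\<close>. The remaining singularity of \<open>1 / g (U \<theta>)\<close> at
  \<open>\<theta> = -1\<close> and \<open>\<theta> = 1\<close> is integrable, so \<open>S\<close> is finite. Rescaling the time interval to \<open>{0..1}\<close>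
  turns \<open>S\<close> into the eigenvalue \<open>2 G(\<alpha>) S\<^sup>2\<close>.
\<close>

lemma solution_exists:
  assumes \<alpha>: "\<alpha> > 0"
  shows "\<exists>lam > 0. \<exists>u. is_solution lam u \<and> sup_norm u = \<alpha>"
proof -
  define \<beta> where "\<beta> = potential \<alpha>"
  have \<beta>: "\<beta> > 0" using potential_strict_mono[of 0 \<alpha>] \<alpha> by (simp add: \<beta>_def)
  have dg_pos: "diffusion x * reaction x > 0" if "x > 0" for x
    using diffusion_pos[OF that] reaction_pos[OF that] by simp
  have \<beta>lt: "\<beta> < potential (\<alpha> + 1)" using potential_strict_mono[of \<alpha> "\<alpha> + 1"] \<alpha> by (simp add: \<beta>_def)
  \<comment> \<open>The inverse of the potential is taken beyond \<open>\<alpha>\<close> so that it is differentiable at \<open>\<beta>\<close>, the value reached at \<open>\<theta> = 0\<close>.\<close>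
  obtain k where contk: "continuous_on {0..potential (\<alpha> + 1)} k"
    and kp: "\<And>x. x \<in> {0..\<alpha> + 1} \<Longrightarrow> k (potential x) = x"
    and pk: "\<And>y. y \<in> {0..potential (\<alpha> + 1)} \<Longrightarrow> k y \<in> {0..\<alpha> + 1} \<and> potential (k y) = y"
    and kin: "\<And>y. y \<in> {0<..<potential (\<alpha> + 1)} \<Longrightarrow> k y \<in> {0<..<\<alpha> + 1}"
    and dk: "\<And>y. y \<in> {0<..<potential (\<alpha> + 1)} \<Longrightarrow>
       (k has_real_derivative inverse (diffusion (k y) * reaction (k y))) (at y)"
  proof (rule increasing_differentiable_inverse[of 0 "\<alpha> + 1" potential "\<lambda>x. diffusion x * reaction x"])
    show "continuous_on {0..\<alpha> + 1} potential" by (rule continuous_on_potential)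
    show "\<And>x. x \<in> {0<..<\<alpha> + 1} \<Longrightarrow> 0 < diffusion x * reaction x" using dg_pos by auto
    show "(potential has_real_derivative diffusion x * reaction x) (at x)" for x
      by (rule has_derivative_potential)
  qed (use \<alpha> in auto)
  define U where "U \<theta> = k (\<beta> * (1 - \<theta>\<^sup>2))" for \<theta>
  have arg: "\<beta> * (1 - \<theta>\<^sup>2) \<in> {0..\<beta>}" if "\<theta> \<in> {-1..1}" for \<theta>
    using \<beta> that by (auto simp: abs_square_le_1 mult_le_cancel_left1)
  have arg': "\<beta> * (1 - \<theta>\<^sup>2) \<in> {0<..<potential (\<alpha> + 1)}" if "\<theta> \<in> {-1<..<1}" for \<theta>
  proof -
    have "\<theta>\<^sup>2 < 1" using that by (auto simp: abs_square_less_1)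
    then have "0 < \<beta> * (1 - \<theta>\<^sup>2)" using \<beta> by simp
    moreover have "\<beta> * (1 - \<theta>\<^sup>2) \<le> \<beta>" using arg[of \<theta>] that by auto
    ultimately show ?thesis using \<beta>lt by auto
  qed
  have argB: "\<beta> * (1 - \<theta>\<^sup>2) \<in> {0..potential (\<alpha> + 1)}" if "\<theta> \<in> {-1..1}" for \<theta>
    using arg[OF that] \<beta>lt unfolding atLeastAtMost_iff by linarith
  have contU: "continuous_on {-1..1} U"
    unfolding U_def
  proof (intro continuous_on_compose2[OF contk] continuous_intros)
    show "(\<lambda>\<theta>. \<beta> * (1 - \<theta>\<^sup>2)) ` {-1..1} \<subseteq> {0..potential (\<alpha> + 1)}"
      using argB by (rule image_subsetI)
  qed
  have potU: "potential (U \<theta>) = \<beta> * (1 - \<theta>\<^sup>2)" if "\<theta> \<in> {-1..1}" for \<theta>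
    unfolding U_def using pk[OF argB[OF that]] by (rule conjunct2)
  have Uge: "U \<theta> \<ge> 0" if "\<theta> \<in> {-1..1}" for \<theta>
    unfolding U_def using pk[OF argB[OF that]] unfolding atLeastAtMost_iff by blast
  have Ule: "U \<theta> \<le> \<alpha>" if "\<theta> \<in> {-1..1}" for \<theta>
  proof (rule ccontr)
    assume "\<not> U \<theta> \<le> \<alpha>"
    then have "\<beta> < potential (U \<theta>)" using potential_strict_mono[of \<alpha> "U \<theta>"] \<alpha> by (simp add: \<beta>_def)
    then show False using potU[OF that] arg[OF that] by auto
  qed
  have Upos: "U \<theta> > 0" if "\<theta> \<in> {-1<..<1}" for \<theta>
    using kin[OF arg'[OF that]] by (simp add: U_def)
  have U0: "U 0 = \<alpha>" using kp[of \<alpha>] \<alpha> by (simp add: U_def \<beta>_def)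
  have U1: "U 1 = 0" "U (-1) = 0" using kp[of 0] \<alpha> by (simp_all add: U_def)
  have dU: "(U has_real_derivative - (2 * \<beta> * \<theta>) / (diffusion (U \<theta>) * reaction (U \<theta>))) (at \<theta>)"
    if "\<theta> \<in> {-1<..<1}" for \<theta>
  proof -
    have "((\<lambda>x. k (\<beta> * (1 - x\<^sup>2))) has_real_derivative
       inverse (diffusion (k (\<beta> * (1 - \<theta>\<^sup>2))) * reaction (k (\<beta> * (1 - \<theta>\<^sup>2)))) * (- (2 * \<beta> * \<theta>))) (at \<theta>)"
      by (rule DERIV_chain2[of k _ "\<lambda>x. \<beta> * (1 - x\<^sup>2)", OF dk[OF arg'[OF that]]])
         (auto intro!: derivative_eq_intros)
    then show ?thesis unfolding U_def[abs_def] by (simp add: divide_inverse mult.commute)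
  qed
  define a where "a \<theta> = inverse (reaction (U \<theta>))" for \<theta>
  have apos: "a \<theta> > 0" if "\<theta> \<in> {-1<..<1}" for \<theta>
    using reaction_pos[OF Upos[OF that]] by (simp add: a_def)
  have conta: "continuous_on {-1<..<1} a"
    unfolding a_def reaction_def
  proof (intro continuous_intros)
    show "continuous_on {-1<..<1} U" using contU by (rule continuous_on_subset) auto
    then show "continuous_on {-1<..<1} U" .
    show "\<forall>\<theta>\<in>{-1<..<1}. U \<theta> + sin (U \<theta>) \<noteq> 0"
      using reaction_pos[OF Upos] unfolding reaction_def by force
  qed
  \<comment> \<open>As \<open>\<beta> (1 - \<theta>\<^sup>2) = G (U \<theta>)\<close> is at most a multiple of \<open>(U \<theta>)\<^sup>2\<close>, the integrand is dominated by a multiple of the derivative of \<open>arcsin\<close>.\<close>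
  have inta: "a integrable_on {-1..1}"
  proof (rule integrable_on_Icc_dominated[OF conta])
    define c where "c = 2 * sqrt (\<alpha> * (\<alpha> + 1) / \<beta>)"
    have "((\<lambda>x::real. 1 / sqrt (1 - x\<^sup>2)) has_integral (arcsin 1 - arcsin (-1))) {-1..1}"
    proof (rule fundamental_theorem_of_calculus_interior)
      show "continuous_on {-1..1} arcsin" by (rule continuous_on_arcsin') 
      fix x :: real assume "x \<in> {-1<..<1}"
      then show "(arcsin has_vector_derivative 1 / sqrt (1 - x\<^sup>2)) (at x)"
        using DERIV_arcsin[of x] by (simp add: has_real_derivative_iff_has_vector_derivative divide_inverse)
    qed simp
    then show "(\<lambda>x. c * (1 / sqrt (1 - x\<^sup>2))) integrable_on {-1..1}"
      by (intro integrable_on_mult_right) blast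
    fix \<theta> :: real assume \<theta>: "\<theta> \<in> {-1<..<1}"
    have sq: "\<theta>\<^sup>2 < 1" using \<theta> by (auto simp: abs_square_less_1)
    have "\<beta> * (1 - \<theta>\<^sup>2) \<le> \<alpha> * (\<alpha> + 1) * (U \<theta>)\<^sup>2"
      using potential_le_square[of "U \<theta>" \<alpha>] potU[of \<theta>] Uge[of \<theta>] Ule[of \<theta>] \<theta> by auto
    then have "(1 - \<theta>\<^sup>2) \<le> (\<alpha> * (\<alpha> + 1) / \<beta>) * (U \<theta>)\<^sup>2" using \<beta> by (simp add: field_simps)
    then have "sqrt (1 - \<theta>\<^sup>2) \<le> sqrt (\<alpha> * (\<alpha> + 1) / \<beta>) * U \<theta>"
      using Upos[OF \<theta>] by (metis abs_of_pos real_sqrt_abs real_sqrt_le_iff real_sqrt_mult)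
    then have "1 / U \<theta> \<le> (c / 2) * (1 / sqrt (1 - \<theta>\<^sup>2))"
      using Upos[OF \<theta>] sq by (simp add: c_def divide_simps mult.commute)
    moreover have "a \<theta> \<le> 2 * (1 / U \<theta>)"
      using reaction_ge_half[of "U \<theta>"] Upos[OF \<theta>] reaction_pos[OF Upos[OF \<theta>]]
      by (simp add: a_def divide_simps)
    ultimately show "\<bar>a \<theta>\<bar> \<le> c * (1 / sqrt (1 - \<theta>\<^sup>2))" using apos[OF \<theta>] by simp
  qed
  define s where "s \<theta> = integral {-1..\<theta>} a" for \<theta>
  have conts: "continuous_on {-1..1} s"
    unfolding s_def by (rule indefinite_integral_continuous_1[OF inta])
  have ds: "(s has_real_derivative a \<theta>) (at \<theta>)" if \<theta>: "\<theta> \<in> {-1<..<1}" for \<theta>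
  proof -
    have "isCont a \<theta>" using conta \<theta> by (simp add: continuous_on_eq_continuous_at)
    then have "((\<lambda>u. integral {-1..u} a) has_vector_derivative a \<theta>) (at \<theta> within ({-1..1} - {}))"
      using \<theta> by (intro integral_has_vector_derivative_continuous_at[OF inta])
        (auto intro: continuous_at_imp_continuous_at_within)
    then show ?thesis
      using \<theta> at_within_interior[of \<theta> "{-1..1}"]
      unfolding s_def by (simp add: has_real_derivative_iff_has_vector_derivative)
  qed
  define S where "S = s 1"
  have s0: "s (-1) = 0" by (simp add: s_def)
  obtain th where S: "0 < S" and contth: "continuous_on {0..S} th"
    and ths: "\<And>\<theta>. \<theta> \<in> {-1..1} \<Longrightarrow> th (s \<theta>) = \<theta>"
    and sth: "\<And>\<tau>. \<tau> \<in> {0..S} \<Longrightarrow> th \<tau> \<in> {-1..1} \<and> s (th \<tau>) = \<tau>"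
    and thin: "\<And>\<tau>. \<tau> \<in> {0<..<S} \<Longrightarrow> th \<tau> \<in> {-1<..<1}"
    and dth: "\<And>\<tau>. \<tau> \<in> {0<..<S} \<Longrightarrow> (th has_real_derivative inverse (a (th \<tau>))) (at \<tau>)"
  proof (rule increasing_differentiable_inverse[of "-1" 1 s a, OF _ conts ds apos, unfolded s0 S_def[symmetric]])
    show "(-1::real) < 1" by simp
  qed auto
  \<comment> \<open>The parameter \<open>w\<close> is \<open>\<theta>\<close> as a function of the normalised time.\<close>
  define u where "u t = U (th (S * t))" for t
  define w where "w t = th (S * t)" for t
  have St: "S * t \<in> {0..S}" if "t \<in> {0..1}" for t using that S by (auto simp: mult_left_le)
  have St': "S * t \<in> {0<..<S}" if "t \<in> {0<..<1}" for t using that S by auto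
  have upos: "u t > 0" if "t \<in> {0<..<1}" for t
    unfolding u_def by (rule Upos[OF thin[OF St'[OF that]]])
  have dw: "(w has_real_derivative reaction (u t) * S) (at t)" if t: "t \<in> {0<..<1}" for t
  proof -
    have "((\<lambda>t. th (S * t)) has_real_derivative inverse (a (th (S * t))) * S) (at t)"
      by (rule DERIV_chain2[of th _ "\<lambda>t. S * t", OF dth[OF St'[OF t]]])
         (auto intro!: derivative_eq_intros)
    then show ?thesis unfolding w_def[abs_def] by (simp add: u_def a_def)
  qed
  \<comment> \<open>In these terms the flux \<open>D(u) u'\<close> is \<open>- 2 \<beta> S w\<close>, which is why \<open>u'\<close> is differentiable also at the maximum.\<close>
  define u' where "u' t = - (2 * \<beta> * S) * w t / diffusion (u t)" for t
  have du: "(u has_real_derivative u' t) (at t)" if t: "t \<in> {0<..<1}" for t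
  proof -
    have "((\<lambda>t. U (w t)) has_real_derivative
       - (2 * \<beta> * w t) / (diffusion (U (w t)) * reaction (U (w t))) * (reaction (u t) * S)) (at t)"
      by (rule DERIV_chain2[of U _ w, OF dU dw[OF t]]) (use thin[OF St'[OF t]] in \<open>simp add: w_def\<close>)
    moreover have "- (2 * \<beta> * w t) / (diffusion (U (w t)) * reaction (U (w t))) * (reaction (u t) * S) = u' t"
      using reaction_pos[OF upos[OF t]] diffusion_pos[OF upos[OF t]]
      by (simp add: u'_def u_def w_def)
    ultimately show ?thesis by (simp add: u_def[abs_def] w_def)
  qed
  have ddiff: "((\<lambda>t. diffusion (u t)) has_real_derivative (2 * u t + cos (u t)) * u' t) (at t)"
    if t: "t \<in> {0<..<1}" for t
    unfolding diffusion_def by (auto intro!: derivative_eq_intros du[OF t] simp: algebra_simps)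
  define u'' where "u'' t = - (2 * \<beta> * S) *
     (reaction (u t) * S * diffusion (u t) - w t * ((2 * u t + cos (u t)) * u' t)) / (diffusion (u t) * diffusion (u t))" for t
  have du': "(u' has_real_derivative u'' t) (at t)" if t: "t \<in> {0<..<1}" for t
  proof -
    have "((\<lambda>t. - (2 * \<beta> * S) * (w t / diffusion (u t))) has_real_derivative
      - (2 * \<beta> * S) * ((reaction (u t) * S * diffusion (u t) - w t * ((2 * u t + cos (u t)) * u' t))
         / (diffusion (u t) * diffusion (u t)))) (at t)"
      using diffusion_pos[OF upos[OF t]]
      by (intro DERIV_cmult DERIV_divide dw[OF t] ddiff[OF t]) auto
    then show ?thesis unfolding u'_def[abs_def] u''_def by simp
  qed
  have deriv_u: "deriv u t = u' t" if "t \<in> {0<..<1}" for t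
    using du[OF that] by (rule DERIV_imp_deriv)
  have du2: "(deriv u has_real_derivative u'' t) (at t)" if t: "t \<in> {0<..<1}" for t
    by (rule has_field_derivative_transform_within_open[OF du'[OF t], of "{0<..<1}"])
       (use t deriv_u in auto)
  have deriv_u2: "deriv (deriv u) t = u'' t" if "t \<in> {0<..<1}" for t
    using du2[OF that] by (rule DERIV_imp_deriv)
  have contu: "continuous_on {0..1} u"
    unfolding u_def
  proof (rule continuous_on_compose2[OF contU])
    show "continuous_on {0..1} (\<lambda>t. th (S * t))"
      using St by (intro continuous_on_compose2[OF contth] continuous_intros) auto
    show "(\<lambda>t. th (S * t)) ` {0..1} \<subseteq> {-1..1}" using sth[OF St] by blast
  qed
  have c1: "continuous_on {0<..<1} u" "continuous_on {0<..<1} w" "continuous_on {0<..<1} u'"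
    using DERIV_isCont[OF du] DERIV_isCont[OF dw] DERIV_isCont[OF du']
    by (simp_all add: continuous_at_imp_continuous_on)
  have "continuous_on {0<..<1} u''"
    unfolding u''_def diffusion_def reaction_def
    using diffusion_pos[OF upos] unfolding diffusion_def
    by (intro continuous_intros c1) (force simp: less_imp_neq[symmetric])
  then have c2: "continuous_on {0<..<1} (deriv (deriv u))"
    by (subst continuous_on_cong[OF refl deriv_u2]) auto
  have C2: "C2_interior u"
    unfolding C2_interior_def differentiable_on_eq_differentiable_at[OF open_greaterThanLessThan]
      real_differentiable_def
    using contu c2 du du2 by blast
  have eqn: "deriv (\<lambda>s. diffusion (u s) * deriv u s) t + 2 * \<beta> * S\<^sup>2 * reaction (u t) = 0"
    if t: "t \<in> {0<..<1}" for t
  proof -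
    have "((\<lambda>s. - (2 * \<beta> * S) * w s) has_real_derivative - (2 * \<beta> * S) * (reaction (u t) * S)) (at t)"
      by (rule DERIV_cmult[OF dw[OF t]])
    then have "((\<lambda>s. diffusion (u s) * deriv u s) has_real_derivative - (2 * \<beta> * S) * (reaction (u t) * S)) (at t)"
    proof (rule has_field_derivative_transform_within_open[of _ _ _ "{0<..<1}"])
      fix x :: real assume x: "x \<in> {0<..<1}"
      show "- (2 * \<beta> * S) * w x = diffusion (u x) * deriv u x"
        using diffusion_pos[OF upos[OF x]] by (simp add: deriv_u[OF x] u'_def)
    qed (use t in auto)
    then show ?thesis by (simp add: DERIV_imp_deriv power2_eq_square)
  qed
  have th0: "th 0 = -1" "th S = 1" using ths[of "-1"] ths[of 1] s0 S_def by auto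
  have sol: "is_solution (2 * \<beta> * S\<^sup>2) u"
    unfolding is_solution_def
    using C2 eqn upos th0 U1 by (auto simp: diffusion_def reaction_def u_def)
  have "sup_norm u = \<alpha>"
    unfolding sup_norm_def
  proof (rule cSup_eq_maximum)
    have s0in: "s 0 / S \<in> {0..1}"
    proof -
      have "a \<theta> \<ge> 0" if "\<theta> \<in> {-1..1}" for \<theta>
        using reaction_ge_half[of "U \<theta>"] Uge[OF that] by (simp add: a_def)
      then have "s (-1) \<le> s 0" "s 0 \<le> s 1"
        unfolding s_def
        by (intro integral_subset_le integrable_on_subinterval[OF inta]; simp)+
      then show ?thesis using S s0 by (simp add: S_def)
    qed
    have "u (s 0 / S) = \<alpha>" using S ths[of 0] U0 by (simp add: u_def)
    then show "\<alpha> \<in> (\<lambda>t. \<bar>u t\<bar>) ` {0..1}" using s0in \<alpha> by (intro image_eqI[of _ _ "s 0 / S"]) auto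
    fix y assume "y \<in> (\<lambda>t. \<bar>u t\<bar>) ` {0..1}"
    then obtain t where t: "t \<in> {0..1}" "y = \<bar>u t\<bar>" by auto
    have "th (S * t) \<in> {-1..1}" using sth[OF St[OF t(1)]] by simp
    then show "y \<le> \<alpha>" using Uge[of "th (S * t)"] Ule[of "th (S * t)"] t(2) by (simp add: u_def)
  qed
  moreover have "2 * \<beta> * S\<^sup>2 > 0" using \<beta> S by simp
  ultimately show ?thesis using sol by blast
qed

theorem bif_lambda_eq_time_map:
  assumes "\<alpha> > 0"
  shows "bif_lambda \<alpha> = 2 * (time_map \<alpha>)\<^sup>2"
    and "(\<lambda>w. diffusion w / sqrt (potential \<alpha> - potential w)) integrable_on {0..\<alpha>}"
proof -
  obtain lam u where *: "lam > 0" "is_solution lam u" "sup_norm u = \<alpha>"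
    using solution_exists[OF assms] by blast
  have "bif_lambda \<alpha> = lam"
    unfolding bif_lambda_def using * solution_lambda(1) by (intro the_equality) blast+
  then show "bif_lambda \<alpha> = 2 * (time_map \<alpha>)\<^sup>2"
    using solution_lambda(1)[OF *(2,1,3)] by simp
  show "(\<lambda>w. diffusion w / sqrt (potential \<alpha> - potential w)) integrable_on {0..\<alpha>}"
    by (rule solution_lambda(2)[OF *(2,1,3)])
qed


section \<open>Two oscillatory integrals on the half-line\<close>

lemma has_bochner_integral_FTC_Ioi:
  fixes f F :: "real \<Rightarrow> real"
  assumes F: "\<And>x. x > a \<Longrightarrow> (F has_real_derivative f x) (at x)"
    and f: "\<And>x. x > a \<Longrightarrow> isCont f x" and nonneg: "\<And>x. x > a \<Longrightarrow> 0 \<le> f x"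
    and A: "(F \<longlongrightarrow> A) (at_right a)" and B: "(F \<longlongrightarrow> B) at_top"
  shows "has_bochner_integral lborel (\<lambda>x. indicator {a<..} x * f x) (B - A)"
proof -
  have "set_integrable lborel (einterval (ereal a) \<infinity>) f"
    and "(LBINT x=ereal a..\<infinity>. f x) = B - A"
    by (rule interval_integral_FTC_nonneg[of "ereal a" \<infinity> F f A B];
        use assms in \<open>simp add: ereal_tendsto_simps\<close>)+
  then show ?thesis
    by (simp add: has_bochner_integral_iff set_integrable_def interval_integral_to_infinity_eq
        set_lebesgue_integral_def)
qed

text \<open>
  Laplace transforms of \<open>sin x\<close> and \<open>1 - cos x\<close>. Adding \<open>exp (- (a * x))\<close> to the first integrand makes
  it nonnegative, so that integrability follows from an explicit primitive; both integrands are
  then of the form treated in \<open>shifted\<close>.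
\<close>

lemma
  fixes a :: real
  assumes a: "a > 0"
  shows has_bochner_integral_exp_sin:
      "has_bochner_integral lborel (\<lambda>x. indicator {0<..} x * (exp (- (a * x)) * sin x)) (1 / (1 + a\<^sup>2))"
    and has_bochner_integral_exp_one_minus_cos:
      "has_bochner_integral lborel (\<lambda>x. indicator {0<..} x * (exp (- (a * x)) * (1 - cos x)))
         (1 / (a * (1 + a\<^sup>2)))"
proof -
  have e0: "((\<lambda>x. exp (- (a * x))) \<longlongrightarrow> 0) at_top" using a by real_asymp
  have trig0: "((\<lambda>x. exp (- (a * x)) * (p * sin x + q * cos x)) \<longlongrightarrow> 0) at_top" for p q :: real
  proof (rule Lim_null_comparison)
    show "\<forall>\<^sub>F x in at_top. norm (exp (- (a * x)) * (p * sin x + q * cos x)) \<le> exp (- (a * x)) * (\<bar>p\<bar> + \<bar>q\<bar>)"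
    proof (rule always_eventually, rule allI)
      fix x
      have "\<bar>p * sin x\<bar> \<le> \<bar>p\<bar>" "\<bar>q * cos x\<bar> \<le> \<bar>q\<bar>"
        by (simp_all add: abs_mult mult_left_le)
      then have "\<bar>p * sin x + q * cos x\<bar> \<le> \<bar>p\<bar> + \<bar>q\<bar>" by linarith
      then show "norm (exp (- (a * x)) * (p * sin x + q * cos x)) \<le> exp (- (a * x)) * (\<bar>p\<bar> + \<bar>q\<bar>)"
        by (simp add: abs_mult)
    qed
    show "((\<lambda>x. exp (- (a * x)) * (\<bar>p\<bar> + \<bar>q\<bar>)) \<longlongrightarrow> 0) at_top"
      using tendsto_mult[OF e0 tendsto_const] by simp
  qed
  have ne: "1 + a\<^sup>2 \<noteq> 0" using zero_le_power2[of a] by linarith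
  have plain: "has_bochner_integral lborel (\<lambda>x. indicator {0<..} x * exp (- (a * x))) (0 - (- (1 / a)))"
  proof (rule has_bochner_integral_FTC_Ioi[where F = "\<lambda>x. - exp (- (a * x)) / a"])
    show "((\<lambda>x. - exp (- (a * x)) / a) \<longlongrightarrow> 0) at_top"
      using tendsto_mult[OF e0 tendsto_const[of "- 1 / a"]] by simp
    show "((\<lambda>x. - exp (- (a * x)) / a) \<longlongrightarrow> - (1 / a)) (at_right 0)"
      using a by (auto intro!: tendsto_eq_intros)
  qed (use a in \<open>auto intro!: derivative_eq_intros continuous_intros\<close>)
  have D: "((\<lambda>x. exp (- (a * x)) * (p * sin x + q * cos x)) has_real_derivative
        exp (- (a * x)) * ((- a * p - q) * sin x + (p - a * q) * cos x)) (at x)" for p q x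
    by (rule derivative_eq_intros refl | (simp add: algebra_simps; fail))+
  have cont0: "((\<lambda>x. exp (- (a * x)) * (p * sin x + q * cos x)) \<longlongrightarrow> q) (at_right 0)" for p q :: real
    by (auto intro!: tendsto_eq_intros)
  have D0: "((\<lambda>x. - exp (- (a * x)) / a) has_real_derivative exp (- (a * x))) (at x)" for x
    using a by (auto intro!: derivative_eq_intros)
  have shifted: "has_bochner_integral lborel
      (\<lambda>x. indicator {0<..} x * (exp (- (a * x)) + exp (- (a * x)) * (P * sin x + Q * cos x)))
      (0 - (- (1 / a) + q))"
    if p: "- a * p - q = P" and q: "p - a * q = Q" and bnd: "\<And>x. -1 \<le> P * sin x + Q * cos x" for p q P Q
  proof (rule has_bochner_integral_FTC_Ioi[where
      F = "\<lambda>x. - exp (- (a * x)) / a + exp (- (a * x)) * (p * sin x + q * cos x)"])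
    fix x :: real
    show "((\<lambda>x. - exp (- (a * x)) / a + exp (- (a * x)) * (p * sin x + q * cos x))
      has_real_derivative exp (- (a * x)) + exp (- (a * x)) * (P * sin x + Q * cos x)) (at x)"
      using DERIV_add[OF D0 D[of p q x]] unfolding p q .
    have "0 \<le> exp (- (a * x)) * (1 + (P * sin x + Q * cos x))"
      using bnd[of x] by (intro mult_nonneg_nonneg) auto
    then show "0 \<le> exp (- (a * x)) + exp (- (a * x)) * (P * sin x + Q * cos x)"
      by (simp only: distrib_left mult_1_right)
    show "((\<lambda>x. - exp (- (a * x)) / a + exp (- (a * x)) * (p * sin x + q * cos x)) \<longlongrightarrow> 0) at_top"
      using tendsto_add[OF tendsto_mult[OF e0 tendsto_const[of "- 1 / a"]] trig0[of p q]] by simp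
    have "((\<lambda>x. - exp (- (a * x)) / a) \<longlongrightarrow> - (1 / a)) (at_right 0)"
      using a by (auto intro!: tendsto_eq_intros)
    then show "((\<lambda>x. - exp (- (a * x)) / a + exp (- (a * x)) * (p * sin x + q * cos x))
       \<longlongrightarrow> - (1 / a) + q) (at_right 0)"
      by (rule tendsto_add[OF _ cont0])
    show "isCont (\<lambda>x. exp (- (a * x)) + exp (- (a * x)) * (P * sin x + Q * cos x)) x"
      by (intro continuous_intros)
  qed
  have "has_bochner_integral lborel
      (\<lambda>x. indicator {0<..} x * (exp (- (a * x)) + exp (- (a * x)) * (1 * sin x + 0 * cos x)))
      (0 - (- (1 / a) + - 1 / (1 + a\<^sup>2)))"
  proof (rule shifted[of "- a / (1 + a\<^sup>2)"])
    show "- a * (- a / (1 + a\<^sup>2)) - - 1 / (1 + a\<^sup>2) = 1" "- a / (1 + a\<^sup>2) - a * (- 1 / (1 + a\<^sup>2)) = 0"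
      using ne by (simp_all add: divide_simps power2_eq_square)
  qed (use sin_ge_minus_one in simp)
  from has_bochner_integral_diff[OF this plain]
  show "has_bochner_integral lborel (\<lambda>x. indicator {0<..} x * (exp (- (a * x)) * sin x)) (1 / (1 + a\<^sup>2))"
    by (simp add: right_diff_distrib[symmetric])
  have "has_bochner_integral lborel
      (\<lambda>x. indicator {0<..} x * (exp (- (a * x)) + exp (- (a * x)) * (0 * sin x + (-1) * cos x)))
      (0 - (- (1 / a) + a / (1 + a\<^sup>2)))"
  proof (rule shifted[of "- 1 / (1 + a\<^sup>2)"])
    show "- a * (- 1 / (1 + a\<^sup>2)) - a / (1 + a\<^sup>2) = 0" "- 1 / (1 + a\<^sup>2) - a * (a / (1 + a\<^sup>2)) = -1"
      using ne by (simp_all add: divide_simps power2_eq_square)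
  qed simp
  moreover have "0 - (- (1 / a) + a / (1 + a\<^sup>2)) = 1 / (a * (1 + a\<^sup>2))"
    using a ne by (simp add: divide_simps power2_eq_square)
  moreover have "exp (- (a * x)) + exp (- (a * x)) * (0 * sin x + (-1) * cos x) = exp (- (a * x)) * (1 - cos x)" for x
    by (simp add: right_diff_distrib)
  ultimately show "has_bochner_integral lborel (\<lambda>x. indicator {0<..} x * (exp (- (a * x)) * (1 - cos x)))
         (1 / (a * (1 + a\<^sup>2)))" by simp
qed

text \<open>
  The integrand is \<open>1 / (1 + v\<^sup>4)\<close> for \<open>\<sigma> = 1\<close> and \<open>v\<^sup>2 / (1 + v\<^sup>4)\<close> for \<open>\<sigma> = -1\<close>. The two primitives
  share the arctangent part and differ in the sign of the logarithmic part, which vanishes at both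
  ends; hence the common value.
\<close>

lemma has_bochner_integral_quartic:
  fixes \<sigma> :: real
  assumes \<sigma>: "\<bar>\<sigma>\<bar> = 1"
  shows "has_bochner_integral lborel
    (\<lambda>v. indicator {0<..} v * (((1 + v\<^sup>2) + \<sigma> * (1 - v\<^sup>2)) / (2 * (1 + v ^ 4)))) (pi / (2 * sqrt 2))"
proof -
  define r :: real where "r = sqrt 2"
  have r: "r > 0" "r * r = 2" by (simp_all add: r_def)
  define F where "F v = \<sigma> / (4 * r) * (ln (v\<^sup>2 + r * v + 1) - ln (v\<^sup>2 - r * v + 1))
     + 1 / (2 * r) * (arctan (r * v + 1) + arctan (r * v - 1))" for v
  have p: "v\<^sup>2 + r * v + 1 > 0" and q: "v\<^sup>2 - r * v + 1 > 0" for v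
  proof -
    have "v\<^sup>2 + r * v + 1 = (v + r / 2)\<^sup>2 + 1 / 2" "v\<^sup>2 - r * v + 1 = (v - r / 2)\<^sup>2 + 1 / 2"
      using r by (simp_all add: power2_eq_square algebra_simps)
    then show "v\<^sup>2 + r * v + 1 > 0" "v\<^sup>2 - r * v + 1 > 0"
      by (simp_all add: add_nonneg_pos)
  qed
  have pq: "(v\<^sup>2 + r * v + 1) * (v\<^sup>2 - r * v + 1) = 1 + v ^ 4" for v
  proof -
    have "(v\<^sup>2 + r * v + 1) * (v\<^sup>2 - r * v + 1) = (v\<^sup>2 + 1)\<^sup>2 - (r * r) * v\<^sup>2"
      by (simp add: power2_eq_square algebra_simps)
    then show ?thesis using r by (simp add: power2_eq_square power4_eq_xxxx algebra_simps)
  qed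
  have D: "(F has_real_derivative ((1 + v\<^sup>2) + \<sigma> * (1 - v\<^sup>2)) / (2 * (1 + v ^ 4))) (at v)" for v
  proof -
    define P where "P = v\<^sup>2 + r * v + 1"
    define Q where "Q = v\<^sup>2 - r * v + 1"
    have PQ: "P > 0" "Q > 0" "P * Q = 1 + v ^ 4" using p q pq by (auto simp: P_def Q_def)
    have at: "1 + (r * v + 1)\<^sup>2 = 2 * P" "1 + (r * v - 1)\<^sup>2 = 2 * Q"
      using r by (simp_all add: P_def Q_def power2_eq_square algebra_simps)
    have "(F has_real_derivative \<sigma> / (4 * r) * ((2 * v + r) / P - (2 * v - r) / Q)
       + 1 / (2 * r) * (r / (2 * P) + r / (2 * Q))) (at v)"
      unfolding F_def[abs_def]
    proof (intro DERIV_add DERIV_diff DERIV_cmult)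
      have "((\<lambda>v. v\<^sup>2 + r * v + 1) has_real_derivative 2 * v + r) (at v)"
        "((\<lambda>v. v\<^sup>2 - r * v + 1) has_real_derivative 2 * v - r) (at v)"
        by (auto intro!: derivative_eq_intros)
      then show "((\<lambda>v. ln (v\<^sup>2 + r * v + 1)) has_real_derivative (2 * v + r) / P) (at v)"
        "((\<lambda>v. ln (v\<^sup>2 - r * v + 1)) has_real_derivative (2 * v - r) / Q) (at v)"
        using DERIV_chain2[of ln _ "\<lambda>v. v\<^sup>2 + r * v + 1", OF DERIV_ln[OF p[of v]]]
          DERIV_chain2[of ln _ "\<lambda>v. v\<^sup>2 - r * v + 1", OF DERIV_ln[OF q[of v]]]
        unfolding P_def Q_def by (simp_all only: divide_inverse mult.commute)
      have "((\<lambda>v. arctan (r * v + 1)) has_real_derivative inverse (1 + (r * v + 1)\<^sup>2) * r) (at v)"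
        "((\<lambda>v. arctan (r * v - 1)) has_real_derivative inverse (1 + (r * v - 1)\<^sup>2) * r) (at v)"
        by (auto intro!: DERIV_chain2[OF DERIV_arctan] derivative_eq_intros)
      then show "((\<lambda>v. arctan (r * v + 1)) has_real_derivative r / (2 * P)) (at v)"
        "((\<lambda>v. arctan (r * v - 1)) has_real_derivative r / (2 * Q)) (at v)"
        unfolding at divide_inverse mult.commute[of r "inverse (2 * P)"] mult.commute[of r "inverse (2 * Q)"] .
    qed
    also have "(2 * v + r) / P - (2 * v - r) / Q = r * (2 - 2 * v\<^sup>2) / (P * Q)"
    proof -
      have "(2 * v + r) / P - (2 * v - r) / Q = (2 * v * (Q - P) + r * (P + Q)) / (P * Q)"
        using PQ by (simp add: field_simps)
      also have "2 * v * (Q - P) + r * (P + Q) = r * (2 - 2 * v\<^sup>2)"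
        by (simp add: P_def Q_def power2_eq_square algebra_simps)
      finally show ?thesis .
    qed
    also have "r / (2 * P) + r / (2 * Q) = r * (1 + v\<^sup>2) / (P * Q)"
    proof -
      have "r / (2 * P) + r / (2 * Q) = r * ((P + Q) / 2) / (P * Q)"
        using PQ by (simp add: field_simps)
      also have "(P + Q) / 2 = 1 + v\<^sup>2" by (simp add: P_def Q_def)
      finally show ?thesis .
    qed
    also have "\<sigma> / (4 * r) * (r * (2 - 2 * v\<^sup>2) / (P * Q)) + 1 / (2 * r) * (r * (1 + v\<^sup>2) / (P * Q))
      = ((1 + v\<^sup>2) + \<sigma> * (1 - v\<^sup>2)) / (2 * (1 + v ^ 4))"
      using PQ r by (simp add: PQ(3)[symmetric] field_simps)
    finally show ?thesis .
  qed
  have den: "1 + v ^ 4 > 0" for v :: real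
    using zero_le_even_power[of 4 v] by (simp add: add_pos_nonneg)
  have F0: "F 0 = 0" by (simp add: F_def arctan_minus)
  have "has_bochner_integral lborel
    (\<lambda>v. indicator {0<..} v * (((1 + v\<^sup>2) + \<sigma> * (1 - v\<^sup>2)) / (2 * (1 + v ^ 4)))) (pi / (2 * r) - 0)"
  proof (rule has_bochner_integral_FTC_Ioi[OF D])
    fix v :: real
    show "isCont (\<lambda>v. ((1 + v\<^sup>2) + \<sigma> * (1 - v\<^sup>2)) / (2 * (1 + v ^ 4))) v"
      using den[of v] by (intro continuous_intros) auto
    have "0 \<le> (1 + v\<^sup>2) + \<sigma> * (1 - v\<^sup>2)"
      using \<sigma> zero_le_power2[of v] by (cases "\<sigma> = 1") (auto simp: abs_if split: if_splits)
    then show "0 \<le> ((1 + v\<^sup>2) + \<sigma> * (1 - v\<^sup>2)) / (2 * (1 + v ^ 4))"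
      using den[of v] by simp
    show "(F \<longlongrightarrow> 0) (at_right 0)"
      using DERIV_isCont[OF D[of 0]] F0 unfolding isCont_def
      by (metis filterlim_at_split)
    have L: "((\<lambda>v. ln (v\<^sup>2 + r * v + 1) - ln (v\<^sup>2 - r * v + 1)) \<longlongrightarrow> 0) at_top"
      by real_asymp
    have R: "((\<lambda>v. arctan (r * v + 1) + arctan (r * v - 1)) \<longlongrightarrow> pi / 2 + pi / 2) at_top"
      using r(1) by (intro tendsto_add filterlim_compose[OF tendsto_arctan_at_top]) real_asymp+
    have "(F \<longlongrightarrow> \<sigma> / (4 * r) * 0 + 1 / (2 * r) * (pi / 2 + pi / 2)) at_top"
      unfolding F_def[abs_def]
      by (rule tendsto_add[OF tendsto_mult[OF tendsto_const L] tendsto_mult[OF tendsto_const R]])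
    then show "(F \<longlongrightarrow> pi / (2 * r)) at_top" by simp
  qed
  then show ?thesis by (simp add: r_def)
qed

lemma has_bochner_integral_Gaussian_second_moment:
  fixes x :: real
  assumes x: "x > 0"
  shows "has_bochner_integral lborel (\<lambda>v. indicator {0<..} v * (v\<^sup>2 * exp (- (v\<^sup>2 * x))))
    (sqrt pi / 4 / (x * sqrt x))"
proof -
  have "has_bochner_integral lborel (\<lambda>v::real. indicator {0..} v *\<^sub>R (exp (- v\<^sup>2) * v ^ (2 * 1))) (sqrt pi / 4)"
    using gaussian_moment_even_pos[of 1] by (simp add: fact_numeral)
  then have "has_bochner_integral lborel (\<lambda>v. indicator {0..} (0 + sqrt x * v) *\<^sub>R
      (exp (- (0 + sqrt x * v)\<^sup>2) * (0 + sqrt x * v) ^ (2 * 1))) ((sqrt pi / 4) /\<^sub>R \<bar>sqrt x\<bar>)"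
    using x by (subst (asm) lborel_has_bochner_integral_real_affine_iff[where c = "sqrt x" and t = 0]) auto
  then have "has_bochner_integral lborel (\<lambda>v. (1 / x) * (indicator {0..} (0 + sqrt x * v) *\<^sub>R
      (exp (- (0 + sqrt x * v)\<^sup>2) * (0 + sqrt x * v) ^ (2 * 1)))) ((1 / x) * ((sqrt pi / 4) /\<^sub>R \<bar>sqrt x\<bar>))"
    by (intro has_bochner_integral_mult_right) auto
  moreover have "(1 / x) * ((sqrt pi / 4) /\<^sub>R \<bar>sqrt x\<bar>) = sqrt pi / 4 / (x * sqrt x)"
    using x by (simp add: divide_simps)
  moreover have "(1 / x) * (indicator {0..} (0 + sqrt x * v) *\<^sub>R
      (exp (- (0 + sqrt x * v)\<^sup>2) * (0 + sqrt x * v) ^ (2 * 1))) = indicator {0<..} v * (v\<^sup>2 * exp (- (v\<^sup>2 * x)))" for v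
  proof -
    have "(0 + sqrt x * v) ^ (2 * 1) = x * v\<^sup>2" "(0 + sqrt x * v)\<^sup>2 = v\<^sup>2 * x"
      using x by (simp_all add: power_mult_distrib mult.commute)
    moreover consider "v < 0" | "v = 0" | "v > 0" by linarith
    ultimately show ?thesis
      using x by cases (simp_all add: indicator_def zero_le_mult_iff)
  qed
  ultimately show ?thesis by (simp only:)
qed

text \<open>
  The factor \<open>x\<^sup>-\<^sup>3\<^sup>/\<^sup>2\<close> is a multiple of the integral of \<open>v\<^sup>2 exp (- v\<^sup>2 x)\<close> over \<open>v > 0\<close>. Interchanging the
  two integrations leaves the Laplace transform of \<open>f\<close> at \<open>v\<^sup>2\<close>. The two bounds on \<open>f\<close> give the absolute
  integrability that Fubini's theorem asks for, the first near \<open>0\<close> and the second at infinity.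
\<close>

lemma integral_three_halves_via_Laplace:
  fixes f L :: "real \<Rightarrow> real"
  assumes [measurable]: "f \<in> borel_measurable borel"
    and f1: "\<And>x. x > 0 \<Longrightarrow> \<bar>f x\<bar> \<le> x" and f2: "\<And>x. \<bar>f x\<bar> \<le> 2"
    and Lap: "\<And>a. a > 0 \<Longrightarrow>
       has_bochner_integral lborel (\<lambda>x. indicator {0<..} x * (exp (- (a * x)) * f x)) (L a)"
    and J: "has_bochner_integral lborel (\<lambda>v. indicator {0<..} v * (v\<^sup>2 * L (v\<^sup>2))) J"
  shows "has_bochner_integral lborel (\<lambda>x. indicator {0<..} x * (f x / (x * sqrt x))) (4 / sqrt pi * J)"
proof -
  \<comment> \<open>An integrable majorant, up to a constant, of \<open>min 2 x / (x * sqrt x)\<close>.\<close>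
  have bnd: "has_bochner_integral lborel (\<lambda>x. indicator {0<..} x * (1 / ((1 + x) * sqrt x))) (2 * (pi / 2) - 0)"
  proof (rule has_bochner_integral_FTC_Ioi[where F = "\<lambda>x. 2 * arctan (sqrt x)"])
    fix x :: real assume x: "x > 0"
    show "((\<lambda>x. 2 * arctan (sqrt x)) has_real_derivative 1 / ((1 + x) * sqrt x)) (at x)"
    proof -
      have "((\<lambda>x. 2 * arctan (sqrt x)) has_real_derivative 2 * (inverse (1 + (sqrt x)\<^sup>2) * (inverse (sqrt x) / 2))) (at x)"
        by (intro DERIV_cmult DERIV_chain2[of arctan _ sqrt] DERIV_arctan DERIV_real_sqrt x)
      then show ?thesis using x by (simp add: divide_simps)
    qed
    show "isCont (\<lambda>x. 1 / ((1 + x) * sqrt x)) x" using x by (intro continuous_intros) auto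
    show "0 \<le> 1 / ((1 + x) * sqrt x)" using x by simp
  next
    show "((\<lambda>x. 2 * arctan (sqrt x)) \<longlongrightarrow> 0) (at_right 0)"
      by (auto intro!: tendsto_eq_intros)
    show "((\<lambda>x. 2 * arctan (sqrt x)) \<longlongrightarrow> 2 * (pi / 2)) at_top"
      by (intro tendsto_intros filterlim_compose[OF tendsto_arctan_at_top] sqrt_at_top)
  qed
  have int_h: "integrable lborel (\<lambda>x. indicator {0<..} x * (f x / (x * sqrt x)))"
  proof (rule Bochner_Integration.integrable_bound)
    show "integrable lborel (\<lambda>x. 4 * (indicator {0<..} x * (1 / ((1 + x) * sqrt x))) :: real)"
      using bnd by (intro integrable_mult_right) (auto simp: has_bochner_integral_iff)
    show "AE x in lborel. norm (indicator {0<..} x * (f x / (x * sqrt x)))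
       \<le> norm (4 * (indicator {0<..} x * (1 / ((1 + x) * sqrt x))) :: real)"
    proof (rule AE_I2)
      fix x :: real
      show "norm (indicator {0<..} x * (f x / (x * sqrt x)))
        \<le> norm (4 * (indicator {0<..} x * (1 / ((1 + x) * sqrt x))) :: real)"
      proof (cases "x > 0")
        case True
        have "\<bar>f x\<bar> * (1 + x) \<le> 4 * x"
        proof (cases "x \<le> 1")
          case True
          then show ?thesis using f1[OF \<open>x > 0\<close>] \<open>x > 0\<close> mult_mono[of "\<bar>f x\<bar>" x "1 + x" 2] by auto
        next
          case False
          then have "\<bar>f x\<bar> * (1 + x) \<le> 2 * (1 + x)" by (intro mult_right_mono f2) auto
          then show ?thesis using False by simp
        qed
        then show ?thesis using True by (simp add: abs_mult divide_simps)
      qed simp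
    qed
  qed measurable
  define g where "g x v = (indicator {0<..} x * f x) * (indicator {0<..} v * (v\<^sup>2 * exp (- (v\<^sup>2 * x))))" for x v :: real
  have gm [measurable]: "case_prod g \<in> borel_measurable (lborel \<Otimes>\<^sub>M lborel)"
    unfolding g_def by measurable
  have inner_v: "has_bochner_integral lborel (g x)
      (sqrt pi / 4 * (indicator {0<..} x * (f x / (x * sqrt x))))" for x
  proof (cases "x > 0")
    case True
    have "has_bochner_integral lborel (g x) ((indicator {0<..} x * f x) * (sqrt pi / 4 / (x * sqrt x)))"
      unfolding g_def by (intro has_bochner_integral_mult_right has_bochner_integral_Gaussian_second_moment True)
    then show ?thesis by (simp add: mult_ac)
  qed (simp add: g_def[abs_def] has_bochner_integral_zero)
  have inner_abs: "has_bochner_integral lborel (\<lambda>v. norm (g x v))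
      (sqrt pi / 4 * norm (indicator {0<..} x * (f x / (x * sqrt x))))" for x
  proof (cases "x > 0")
    case True
    have "has_bochner_integral lborel (\<lambda>v. \<bar>indicator {0<..} x * f x\<bar> * (indicator {0<..} v * (v\<^sup>2 * exp (- (v\<^sup>2 * x)))))
        (\<bar>indicator {0<..} x * f x\<bar> * (sqrt pi / 4 / (x * sqrt x)))"
      by (intro has_bochner_integral_mult_right has_bochner_integral_Gaussian_second_moment True)
    then show ?thesis using True by (simp add: g_def abs_mult mult_ac)
  qed (simp add: g_def[abs_def] has_bochner_integral_zero)
  have inner_x: "has_bochner_integral lborel (\<lambda>x. g x v) (indicator {0<..} v * (v\<^sup>2 * L (v\<^sup>2)))" for v
  proof (cases "v > 0")
    case True
    have "has_bochner_integral lborel (\<lambda>x. v\<^sup>2 * (indicator {0<..} x * (exp (- (v\<^sup>2 * x)) * f x))) (v\<^sup>2 * L (v\<^sup>2))"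
      by (intro has_bochner_integral_mult_right Lap) (use True in auto)
    then show ?thesis using True by (simp add: g_def mult_ac)
  qed (simp add: g_def[abs_def] has_bochner_integral_zero)
  have "integrable (lborel \<Otimes>\<^sub>M lborel) (case_prod g)"
  proof (rule lborel_pair.Fubini_integrable)
    have "integrable lborel (\<lambda>x. sqrt pi / 4 * norm (indicator {0<..} x * (f x / (x * sqrt x))))"
      by (intro integrable_mult_right integrable_norm int_h)
    then show "integrable lborel (\<lambda>x. LINT v|lborel. norm (case_prod g (x, v)))"
      unfolding prod.case has_bochner_integral_integral_eq[OF inner_abs] .
    show "AE x in lborel. integrable lborel (\<lambda>v. case_prod g (x, v))"
      unfolding prod.case by (rule AE_I2, rule integrable.intros, rule inner_v)
  qed measurable
  then have "(\<integral>v. (\<integral>x. g x v \<partial>lborel) \<partial>lborel) = (\<integral>x. (\<integral>v. g x v \<partial>lborel) \<partial>lborel)"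
    by (rule lborel_pair.Fubini_integral)
  then have "J = sqrt pi / 4 * (\<integral>x. indicator {0<..} x * (f x / (x * sqrt x)) \<partial>lborel)"
    unfolding has_bochner_integral_integral_eq[OF inner_v] has_bochner_integral_integral_eq[OF inner_x]
      has_bochner_integral_integral_eq[OF J] integral_mult_right_zero .
  then have "(\<integral>x. indicator {0<..} x * (f x / (x * sqrt x)) \<partial>lborel) = 4 / sqrt pi * J"
    by (simp add: eq_divide_eq mult.commute)
  then show ?thesis using int_h by (simp only: has_bochner_integral_iff)
qed

lemma has_bochner_integral_sin_three_halves:
  "has_bochner_integral lborel (\<lambda>x. indicator {0<..} x * (sin x / (x * sqrt x))) (sqrt (2 * pi))"
proof -
  have "has_bochner_integral lborel (\<lambda>x. indicator {0<..} x * (sin x / (x * sqrt x)))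
     (4 / sqrt pi * (pi / (2 * sqrt 2)))"
  proof (rule integral_three_halves_via_Laplace[OF _ _ _ has_bochner_integral_exp_sin])
    show "\<bar>sin x\<bar> \<le> x" if "x > 0" for x :: real using abs_sin_x_le_abs_x[of x] that by simp
    show "\<bar>sin x\<bar> \<le> 2" for x :: real using abs_sin_le_one[of x] by linarith
    have "((1 + v\<^sup>2) + (-1) * (1 - v\<^sup>2)) / (2 * (1 + v ^ 4)) = v\<^sup>2 * (1 / (1 + (v\<^sup>2)\<^sup>2))" for v :: real
    proof -
      have "(1 + v\<^sup>2) + (-1) * (1 - v\<^sup>2) = 2 * v\<^sup>2" "(v\<^sup>2)\<^sup>2 = v ^ 4"
        by (simp_all flip: power_mult)
      then show ?thesis by (simp only: mult_divide_mult_cancel_left_if) simp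
    qed
    then show "has_bochner_integral lborel (\<lambda>v. indicator {0<..} v * (v\<^sup>2 * (1 / (1 + (v\<^sup>2)\<^sup>2)))) (pi / (2 * sqrt 2))"
      using has_bochner_integral_quartic[of "-1"] by simp
  qed auto
  moreover have "4 / sqrt pi * (pi / (2 * sqrt 2)) = sqrt (2 * pi)"
    by (simp add: real_sqrt_mult field_simps)
  ultimately show ?thesis by (simp only:)
qed

lemma has_bochner_integral_one_minus_cos_three_halves:
  "has_bochner_integral lborel (\<lambda>x. indicator {0<..} x * ((1 - cos x) / (x * sqrt x))) (sqrt (2 * pi))"
proof -
  have "has_bochner_integral lborel (\<lambda>x. indicator {0<..} x * ((1 - cos x) / (x * sqrt x)))
     (4 / sqrt pi * (pi / (2 * sqrt 2)))"
  proof (rule integral_three_halves_via_Laplace[OF _ _ _ has_bochner_integral_exp_one_minus_cos])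
    show "\<bar>1 - cos x\<bar> \<le> x" if "x > 0" for x :: real
    proof -
      have "cos 0 - cos x \<le> x"
      proof -
        have "(\<lambda>x. x + cos x) 0 \<le> (\<lambda>x. x + cos x) x"
        proof (rule DERIV_nonneg_imp_nondecreasing[of 0 x])
          fix y :: real
          show "\<exists>z. ((\<lambda>x. x + cos x) has_real_derivative z) (at y) \<and> 0 \<le> z"
            by (intro exI[of _ "1 - sin y"]) (auto intro!: derivative_eq_intros)
        qed (use that in simp)
        then show ?thesis by simp
      qed
      then show ?thesis by simp
    qed
    show "\<bar>1 - cos x\<bar> \<le> 2" for x :: real using cos_ge_minus_one[of x] cos_le_one[of x] by linarith
    have "indicator {0<..} v * (((1 + v\<^sup>2) + 1 * (1 - v\<^sup>2)) / (2 * (1 + v ^ 4)))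
      = indicator {0<..} v * (v\<^sup>2 * (1 / (v\<^sup>2 * (1 + (v\<^sup>2)\<^sup>2))))" for v :: real
    proof (cases "v > 0")
      case True
      have "(1 + v\<^sup>2) + 1 * (1 - v\<^sup>2) = 2 * 1" "(v\<^sup>2)\<^sup>2 = v ^ 4"
        by (simp_all flip: power_mult)
      then have "((1 + v\<^sup>2) + 1 * (1 - v\<^sup>2)) / (2 * (1 + v ^ 4)) = v\<^sup>2 * (1 / (v\<^sup>2 * (1 + (v\<^sup>2)\<^sup>2)))"
        using True by (simp only: mult_divide_mult_cancel_left_if) simp
      then show ?thesis by simp
    qed simp
    then show "has_bochner_integral lborel (\<lambda>v. indicator {0<..} v * (v\<^sup>2 * (1 / (v\<^sup>2 * (1 + (v\<^sup>2)\<^sup>2))))) (pi / (2 * sqrt 2))"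
      using has_bochner_integral_quartic[of 1] by simp
  qed auto
  moreover have "4 / sqrt pi * (pi / (2 * sqrt 2)) = sqrt (2 * pi)"
    by (simp add: real_sqrt_mult field_simps)
  ultimately show ?thesis by (simp only:)
qed

text \<open>
  With \<open>x = \<alpha> (1 - s)\<close> the integral becomes \<open>sqrt \<alpha>\<close> times an integral over \<open>{0..\<alpha>}\<close>. Extending it to the
  half-line adds at most the integral \<open>4 / sqrt \<alpha>\<close> of \<open>2 / (x * sqrt x)\<close> over \<open>{\<alpha><..}\<close>, and the value
  on the half-line follows from the addition theorem for the cosine.
\<close>

lemma oscillatory_integral:
  fixes \<alpha> :: real
  assumes \<alpha>: "\<alpha> > 0"
  defines "k \<equiv> \<lambda>s. (cos (\<alpha> * s) - cos \<alpha>) / ((1 - s) * sqrt (1 - s))"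
  shows "k integrable_on {0..1}"
    and "\<bar>integral {0..1} k - 2 * sqrt pi * sqrt \<alpha> * sin (\<alpha> - pi / 4)\<bar> \<le> 4"
proof -
  define K where "K x = (cos (\<alpha> - x) - cos \<alpha>) / (x * sqrt x)" for x
  have K_eq: "K x = sin \<alpha> * (sin x / (x * sqrt x)) - cos \<alpha> * ((1 - cos x) / (x * sqrt x))" for x
    by (simp add: K_def cos_diff right_diff_distrib diff_divide_distrib add_divide_distrib)
  have total: "has_bochner_integral lborel (\<lambda>x. indicator {0<..} x * K x) (sin \<alpha> * sqrt (2 * pi) - cos \<alpha> * sqrt (2 * pi))"
  proof -
    have "has_bochner_integral lborel (\<lambda>x. sin \<alpha> * (indicator {0<..} x * (sin x / (x * sqrt x))) -
        cos \<alpha> * (indicator {0<..} x * ((1 - cos x) / (x * sqrt x)))) (sin \<alpha> * sqrt (2 * pi) - cos \<alpha> * sqrt (2 * pi))"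
      by (intro has_bochner_integral_diff has_bochner_integral_mult_right
          has_bochner_integral_sin_three_halves has_bochner_integral_one_minus_cos_three_halves)
    then show ?thesis unfolding K_eq by (simp add: algebra_simps)
  qed
  have tail: "has_bochner_integral lborel (\<lambda>x. indicator {\<alpha><..} x * (2 / (x * sqrt x))) (0 - (- 4 / sqrt \<alpha>))"
  proof (rule has_bochner_integral_FTC_Ioi[where F = "\<lambda>x. - 4 / sqrt x"])
    fix x :: real assume "x > \<alpha>"
    then have x: "x > 0" using \<alpha> by simp
    show "((\<lambda>x. - 4 / sqrt x) has_real_derivative 2 / (x * sqrt x)) (at x)"
      using x by (auto intro!: derivative_eq_intros simp: field_simps)
    show "isCont (\<lambda>x. 2 / (x * sqrt x)) x" using x by (intro continuous_intros) auto
    show "0 \<le> 2 / (x * sqrt x)" using x by simp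
  next
    show "((\<lambda>x. - 4 / sqrt x) \<longlongrightarrow> - 4 / sqrt \<alpha>) (at_right \<alpha>)"
      using \<alpha> by (auto intro!: tendsto_eq_intros)
    show "((\<lambda>x::real. - 4 / sqrt x) \<longlongrightarrow> 0) at_top" by real_asymp
  qed
  have intK: "set_integrable lborel {0<..} K"
    using total by (simp add: set_integrable_def has_bochner_integral_iff)
  have int1: "set_integrable lborel {0<..\<alpha>} K" and int2: "set_integrable lborel {\<alpha><..} K"
    using \<alpha> by (auto intro!: set_integrable_subset[OF intK])
  have "(LBINT x:{0<..}. K x) = (LBINT x:{0<..\<alpha>}. K x) + (LBINT x:{\<alpha><..}. K x)"
  proof -
    have "{0<..} = {0<..\<alpha>} \<union> {\<alpha><..}" using \<alpha> by auto
    then show ?thesis using set_integral_Un[OF _ int1 int2] by (metis Int_emptyI greaterThanAtMost_iff greaterThan_iff not_less)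
  qed
  moreover have "(LBINT x:{0<..}. K x) = 2 * sqrt pi * sin (\<alpha> - pi / 4)"
  proof -
    have "(LBINT x:{0<..}. K x) = sin \<alpha> * sqrt (2 * pi) - cos \<alpha> * sqrt (2 * pi)"
      using has_bochner_integral_integral_eq[OF total] by (simp add: set_lebesgue_integral_def)
    also have "\<dots> = 2 * sqrt pi * sin (\<alpha> - pi / 4)"
      by (simp add: sin_diff sin_45 cos_45 real_sqrt_mult algebra_simps)
    finally show ?thesis .
  qed
  moreover have "\<bar>LBINT x:{\<alpha><..}. K x\<bar> \<le> 4 / sqrt \<alpha>"
  proof -
    have "norm (LINT x|lborel. indicator {\<alpha><..} x *\<^sub>R K x) \<le> (LINT x|lborel. indicator {\<alpha><..} x * (2 / (x * sqrt x)))"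
    proof (rule Bochner_Integration.integral_norm_bound_integral)
      show "integrable lborel (\<lambda>x. indicator {\<alpha><..} x *\<^sub>R K x)" using int2 by (simp add: set_integrable_def)
      show "integrable lborel (\<lambda>x. indicator {\<alpha><..} x * (2 / (x * sqrt x)))" using tail by (simp add: has_bochner_integral_iff)
      fix x :: real
      have "\<bar>cos (\<alpha> - x) - cos \<alpha>\<bar> \<le> 2"
        using abs_cos_le_one[of "\<alpha> - x"] abs_cos_le_one[of \<alpha>] by linarith
      then show "norm (indicator {\<alpha><..} x *\<^sub>R K x) \<le> indicator {\<alpha><..} x * (2 / (x * sqrt x))"
        using \<alpha> by (auto simp: K_def abs_mult indicator_def intro!: divide_right_mono)
    qed
    also have "\<dots> = 4 / sqrt \<alpha>" using has_bochner_integral_integral_eq[OF tail] by simp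
    finally show ?thesis by (simp add: set_lebesgue_integral_def)
  qed
  ultimately have main: "\<bar>(LBINT x:{0<..\<alpha>}. K x) - 2 * sqrt pi * sin (\<alpha> - pi / 4)\<bar> \<le> 4 / sqrt \<alpha>"
    by linarith
  define I where "I = (LBINT x:{0<..\<alpha>}. K x)"
  have "(K has_integral I) {0<..\<alpha>}"
    using set_borel_integral_eq_integral[OF int1] by (simp add: I_def has_integral_integrable_integral)
  then have "(K has_integral I) {0..\<alpha>}"
    by (subst (asm) has_integral_spike_set_eq[of _ "{0..\<alpha>}"])
       (auto intro: negligible_subset[of "{0}"])
  then have "((\<lambda>s. K (- \<alpha> *\<^sub>R s + \<alpha>)) has_integral (1 / (\<bar>- \<alpha>\<bar> ^ DIM(real))) *\<^sub>R I)
      ((\<lambda>x. (1 / - \<alpha>) *\<^sub>R x + - ((1 / - \<alpha>) *\<^sub>R \<alpha>)) ` cbox 0 \<alpha>)"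
    using \<alpha> by (intro has_integral_affinity) auto
  moreover have "(\<lambda>x. (1 / - \<alpha>) *\<^sub>R x + - ((1 / - \<alpha>) *\<^sub>R \<alpha>)) ` cbox 0 \<alpha> = {0..1}"
  proof -
    have eq: "(\<lambda>x. (1 / - \<alpha>) *\<^sub>R x + - ((1 / - \<alpha>) *\<^sub>R \<alpha>)) = (\<lambda>x. 1 - x / \<alpha>)"
      using \<alpha> by auto
    have "y \<in> (\<lambda>x. 1 - x / \<alpha>) ` {0..\<alpha>}" if "y \<in> {0..1}" for y
      using that \<alpha> by (intro image_eqI[of _ _ "\<alpha> * (1 - y)"]) (auto simp: mult_left_le)
    then have "(\<lambda>x. 1 - x / \<alpha>) ` {0..\<alpha>} = {0..1}" using \<alpha> by auto
    then show ?thesis unfolding eq cbox_interval .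
  qed
  ultimately have "((\<lambda>s. K (\<alpha> * (1 - s))) has_integral I / \<alpha>) {0..1}"
    using \<alpha> by (simp add: algebra_simps)
  then have "((\<lambda>s. (\<alpha> * sqrt \<alpha>) * K (\<alpha> * (1 - s))) has_integral (\<alpha> * sqrt \<alpha>) * (I / \<alpha>)) {0..1}"
    by (rule has_integral_mult_right)
  moreover have "(\<alpha> * sqrt \<alpha>) * K (\<alpha> * (1 - s)) = k s" for s
  proof -
    have "\<alpha> - \<alpha> * (1 - s) = \<alpha> * s" by (simp add: right_diff_distrib)
    then have "K (\<alpha> * (1 - s)) = (cos (\<alpha> * s) - cos \<alpha>) / ((\<alpha> * sqrt \<alpha>) * ((1 - s) * sqrt (1 - s)))"
      unfolding K_def real_sqrt_mult by (simp only: mult_ac)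
    then show ?thesis using \<alpha> by (simp add: k_def)
  qed
  ultimately have k: "(k has_integral sqrt \<alpha> * I) {0..1}" using \<alpha> by simp
  then show "k integrable_on {0..1}" by blast
  have "\<bar>sqrt \<alpha> * I - 2 * sqrt pi * sqrt \<alpha> * sin (\<alpha> - pi / 4)\<bar> = sqrt \<alpha> * \<bar>I - 2 * sqrt pi * sin (\<alpha> - pi / 4)\<bar>"
  proof -
    have "sqrt \<alpha> * I - 2 * sqrt pi * sqrt \<alpha> * sin (\<alpha> - pi / 4) = sqrt \<alpha> * (I - 2 * sqrt pi * sin (\<alpha> - pi / 4))"
      by (simp add: right_diff_distrib)
    then show ?thesis using \<alpha> by (simp add: abs_mult)
  qed
  also have "\<dots> \<le> sqrt \<alpha> * (4 / sqrt \<alpha>)"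
    using main \<alpha> by (intro mult_left_mono) (auto simp: I_def)
  finally show "\<bar>integral {0..1} k - 2 * sqrt pi * sqrt \<alpha> * sin (\<alpha> - pi / 4)\<bar> \<le> 4"
    using integral_unique[OF k] \<alpha> by simp
qed


section \<open>First-order expansion under the integral sign\<close>

lemma has_integral_inverse_sqrt_one_minus:
  "((\<lambda>s::real. 1 / sqrt (1 - s)) has_integral 2) {0..1}"
proof -
  have "((\<lambda>s::real. 1 / sqrt (1 - s)) has_integral (- 2 * sqrt (1 - 1) - (- 2 * sqrt (1 - 0)))) {0..1}"
  proof (rule fundamental_theorem_of_calculus_interior)
    fix s :: real assume "s \<in> {0<..<1}"
    then have "((\<lambda>s. - 2 * sqrt (1 - s)) has_real_derivative 1 / sqrt (1 - s)) (at s)"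
      by (auto intro!: derivative_eq_intros simp: field_simps)
    then show "((\<lambda>s. - 2 * sqrt (1 - s)) has_vector_derivative 1 / sqrt (1 - s)) (at s)"
      by (simp add: has_real_derivative_iff_has_vector_derivative)
  qed (auto intro!: continuous_intros)
  then show ?thesis by simp
qed

lemma integrable_of_bound_inverse_sqrt:
  fixes f :: "real \<Rightarrow> real"
  assumes "continuous_on {0<..<1} f" and "\<And>s. s \<in> {0<..<1} \<Longrightarrow> \<bar>f s\<bar> \<le> B / sqrt (1 - s)"
  shows "f integrable_on {0..1}"
proof (rule integrable_on_Icc_dominated)
  have "(\<lambda>s. B * (1 / sqrt (1 - s))) integrable_on {0..1}"
    using has_integral_inverse_sqrt_one_minus by (intro integrable_on_mult_right) blast
  then show "(\<lambda>s. B / sqrt (1 - s)) integrable_on {0..1}" by simp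
qed (use assms in auto)

lemma integral_bound_inverse_sqrt:
  fixes f :: "real \<Rightarrow> real"
  assumes int: "f integrable_on {0..1}" and bnd: "\<And>s. s \<in> {0<..<1} \<Longrightarrow> \<bar>f s\<bar> \<le> B / sqrt (1 - s)"
  shows "\<bar>integral {0..1} f\<bar> \<le> 2 * B"
proof -
  have g: "((\<lambda>s. B / sqrt (1 - s)) has_integral B * 2) {0..1}"
    using has_integral_mult_right[OF has_integral_inverse_sqrt_one_minus, of B] by simp
  have "norm (integral {0<..<1} f) \<le> integral {0<..<1} (\<lambda>s. B / sqrt (1 - s))"
    using int g bnd
    by (intro integral_norm_bound_integral) (auto simp: integrable_on_open_interval_real)
  then show ?thesis
    using integral_unique[OF g] by (simp add: integral_open_interval_real)
qed

text \<open>
  In terms of \<open>y = sqrt (1 + e / d)\<close> these are rational inequalities, which hold because \<open>y \<ge> 1 / 2\<close>.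
\<close>

lemma inverse_sqrt_expansion:
  fixes d e :: real
  assumes d: "d > 0" and e: "\<bar>e\<bar> \<le> d / 2"
  shows "1 / sqrt (d + e) \<le> 2 / sqrt d"
    and "\<bar>1 / sqrt (d + e) - 1 / sqrt d\<bar> \<le> \<bar>e\<bar> / d / sqrt d"
    and "\<bar>1 / sqrt (d + e) - 1 / sqrt d + e / (2 * d * sqrt d)\<bar> \<le> 2 * (e / d)\<^sup>2 / sqrt d"
proof -
  define x where "x = e / d"
  define y where "y = sqrt (1 + x)"
  have x: "\<bar>x\<bar> \<le> 1 / 2" using assms by (simp add: x_def field_simps)
  have y2: "y * y = 1 + x" using x by (simp add: y_def)
  have y: "y \<ge> 1 / 2"
    unfolding y_def using x by (intro real_le_rsqrt) (auto simp: power2_eq_square)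
  have sq: "sqrt (d + e) = sqrt d * y"
    using d by (simp add: y_def x_def real_sqrt_mult[symmetric] distrib_left)
  have yy: "y + y * y \<ge> 1" using y y2 x by auto
  have E0: "1 / y \<le> 2" using y by (simp add: divide_simps)
  have E1: "1 / y - 1 = - x / (y + y * y)"
  proof -
    have "- x = (1 - y) * (1 + y)" using y2 by (simp add: algebra_simps)
    moreover have "y + y * y = y * (1 + y)" by (simp add: algebra_simps)
    ultimately show ?thesis using y by (simp add: diff_divide_distrib)
  qed
  have E2: "1 / y - 1 + x / 2 = x\<^sup>2 * ((y + 2) / (2 * y * (1 + y)\<^sup>2))"
  proof -
    have x': "x = (y - 1) * (1 + y)" using y2 by (simp add: algebra_simps)
    have "1 / y - 1 + x / 2 = (y - 1)\<^sup>2 * ((y + 2) / (2 * y))"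
      unfolding x' using y by (simp add: field_simps power2_eq_square)
    also have "\<dots> = x\<^sup>2 * ((y + 2) / (2 * y * (1 + y)\<^sup>2))"
      unfolding x' power_mult_distrib using y by simp
    finally show ?thesis .
  qed
  have frac: "(y + 2) / (2 * y * (1 + y)\<^sup>2) \<le> 2"
  proof -
    have "(1 + 2 * y) * 2 \<le> (1 + y)\<^sup>2 * (4 * y)"
      using y by (intro mult_mono) (auto simp: power2_eq_square algebra_simps)
    then have "y + 2 \<le> 2 * (2 * y * (1 + y)\<^sup>2)" using y by (simp add: algebra_simps)
    then show ?thesis using y by (simp add: pos_divide_le_eq)
  qed
  have s1: "1 / sqrt (d + e) = (1 / y) / sqrt d" using d by (simp add: sq)
  show "1 / sqrt (d + e) \<le> 2 / sqrt d"
    unfolding s1 using d E0 by (intro divide_right_mono) auto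
  have "\<bar>1 / y - 1\<bar> \<le> \<bar>x\<bar>"
  proof -
    have "\<bar>1 / y - 1\<bar> = \<bar>x\<bar> / (y + y * y)" unfolding E1 using yy by simp
    also have "\<dots> \<le> \<bar>x\<bar>" using yy by (simp add: pos_divide_le_eq mult_left_le mult_le_cancel_left1)
    finally show ?thesis .
  qed
  then have "\<bar>1 / y - 1\<bar> / sqrt d \<le> \<bar>x\<bar> / sqrt d" using d by (intro divide_right_mono) auto
  moreover have "1 / sqrt (d + e) - 1 / sqrt d = (1 / y - 1) / sqrt d"
    unfolding s1 by (simp add: diff_divide_distrib)
  ultimately show "\<bar>1 / sqrt (d + e) - 1 / sqrt d\<bar> \<le> \<bar>e\<bar> / d / sqrt d"
    using d by (simp add: x_def)
  have "\<bar>1 / y - 1 + x / 2\<bar> \<le> 2 * x\<^sup>2"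
  proof -
    have "\<bar>1 / y - 1 + x / 2\<bar> = x\<^sup>2 * ((y + 2) / (2 * y * (1 + y)\<^sup>2))"
      unfolding E2 using y by (intro abs_of_nonneg) auto
    also have "\<dots> \<le> x\<^sup>2 * 2" using frac by (intro mult_left_mono) auto
    finally show ?thesis by simp
  qed
  then have "\<bar>1 / y - 1 + x / 2\<bar> / sqrt d \<le> 2 * x\<^sup>2 / sqrt d" using d by (intro divide_right_mono) auto
  moreover have "1 / sqrt (d + e) - 1 / sqrt d + e / (2 * d * sqrt d) = (1 / y - 1 + x / 2) / sqrt d"
    unfolding s1 x_def by (simp add: diff_divide_distrib add_divide_distrib)
  ultimately show "\<bar>1 / sqrt (d + e) - 1 / sqrt d + e / (2 * d * sqrt d)\<bar> \<le> 2 * (e / d)\<^sup>2 / sqrt d"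
    using d by (simp add: x_def)
qed

text \<open>
  The remainder splits into the second-order error of the inverse square root, the contribution of
  \<open>\<rho>\<close> to the linear term, and the effect of the perturbation on the small parts \<open>m\<close> and \<open>\<nu>\<close> of the
  numerator; each is of order \<open>\<epsilon>\<^sup>2\<close>. The condition \<open>4 * K * \<epsilon> \<le> 1\<close> ensures that \<open>e + \<rho>\<close> is at most
  half of \<open>d\<close>.
\<close>

lemma perturbed_quotient:
  fixes d e \<rho> n m \<nu> \<epsilon> K :: real
  assumes d: "d > 0" and \<epsilon>: "0 \<le> \<epsilon>" "\<epsilon> \<le> 1" and K: "K \<ge> 1" "4 * K * \<epsilon> \<le> 1"
    and n: "\<bar>n\<bar> \<le> 1" and m: "\<bar>m\<bar> \<le> K * \<epsilon>" and \<nu>: "\<bar>\<nu>\<bar> \<le> K * \<epsilon>\<^sup>2"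
    and e: "\<bar>e\<bar> \<le> K * \<epsilon> * d" and \<rho>: "\<bar>\<rho>\<bar> \<le> K * \<epsilon>\<^sup>2 * d"
  shows "\<bar>(n + m + \<nu>) / sqrt (d + e + \<rho>) - (n / sqrt d + m / sqrt d - n * e / (2 * d * sqrt d))\<bar>
     \<le> 15 * K\<^sup>2 * \<epsilon>\<^sup>2 / sqrt d"
proof -
  define f where "f = e + \<rho>"
  have "\<epsilon>\<^sup>2 \<le> \<epsilon>" using \<epsilon> by (simp add: power2_eq_square mult_left_le)
  then have "K * \<epsilon>\<^sup>2 * d \<le> K * \<epsilon> * d" using K d by simp
  then have f: "\<bar>f\<bar> \<le> 2 * K * \<epsilon> * d" using e \<rho> unfolding f_def by linarith
  also have "\<dots> \<le> d / 2" using mult_right_mono[OF K(2), of d] d by simp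
  finally have f2: "\<bar>f\<bar> \<le> d / 2" .
  have fd: "\<bar>f\<bar> / d \<le> 2 * K * \<epsilon>" using f d by (simp add: pos_divide_le_eq)
  note ex = inverse_sqrt_expansion[OF d f2]
  define S where "S = 1 / sqrt (d + f)"
  define R where "R = 1 / sqrt d"
  have R: "R > 0" and S0: "S \<ge> 0" using d f2 by (auto simp: R_def S_def)
  have S: "S \<le> 2 * R" using ex(1) by (simp add: S_def R_def)
  have SR: "\<bar>S - R\<bar> \<le> (2 * K * \<epsilon>) * R"
  proof -
    have "\<bar>S - R\<bar> \<le> (\<bar>f\<bar> / d) * R" using ex(2) by (simp add: S_def R_def)
    also have "\<dots> \<le> (2 * K * \<epsilon>) * R" using fd R by (intro mult_right_mono) auto
    finally show ?thesis .
  qed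
  have SR2: "\<bar>S - R + f / (2 * d) * R\<bar> \<le> 8 * K\<^sup>2 * \<epsilon>\<^sup>2 * R"
  proof -
    have "\<bar>S - R + f / (2 * d) * R\<bar> \<le> 2 * (\<bar>f\<bar> / d)\<^sup>2 * R"
      using ex(3) by (simp add: S_def R_def power_divide)
    also have "\<dots> \<le> 2 * (2 * K * \<epsilon>)\<^sup>2 * R"
      using fd d R by (intro mult_right_mono mult_left_mono power_mono) auto
    finally show ?thesis by (simp add: power_mult_distrib)
  qed
  have "(n + m + \<nu>) / sqrt (d + e + \<rho>) - (n / sqrt d + m / sqrt d - n * e / (2 * d * sqrt d))
    = n * (S - R + f / (2 * d) * R) - n * (\<rho> / (2 * d) * R) + m * (S - R) + \<nu> * S"
    using d by (simp add: S_def R_def f_def add.assoc algebra_simps add_divide_distrib)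
  also have "\<bar>\<dots>\<bar> \<le> \<bar>n * (S - R + f / (2 * d) * R)\<bar> + \<bar>n * (\<rho> / (2 * d) * R)\<bar> + \<bar>m * (S - R)\<bar> + \<bar>\<nu> * S\<bar>"
    by linarith
  also have "\<dots> \<le> 1 * (8 * K\<^sup>2 * \<epsilon>\<^sup>2 * R) + 1 * (K * \<epsilon>\<^sup>2 / 2 * R) + K * \<epsilon> * ((2 * K * \<epsilon>) * R) + K * \<epsilon>\<^sup>2 * (2 * R)"
    unfolding abs_mult[of n] abs_mult[of m] abs_mult[of \<nu>]
  proof (intro add_mono mult_mono)
    have "\<bar>\<rho> / (2 * d)\<bar> \<le> K * \<epsilon>\<^sup>2 / 2" using \<rho> d by (simp add: field_simps)
    then show "\<bar>\<rho> / (2 * d) * R\<bar> \<le> K * \<epsilon>\<^sup>2 / 2 * R"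
      unfolding abs_mult[of _ R] abs_of_pos[OF R] using R by (intro mult_right_mono) auto
  qed (use n m \<nu> S S0 SR SR2 \<epsilon> K R in auto)
  also have "\<dots> = (10 * K\<^sup>2 + 5 / 2 * K) * \<epsilon>\<^sup>2 * R"
    by (simp add: power2_eq_square field_simps)
  also have "\<dots> \<le> 15 * K\<^sup>2 * \<epsilon>\<^sup>2 * R"
  proof -
    have "K * 1 \<le> K * K" using K by (intro mult_left_mono) auto
    then have "10 * K\<^sup>2 + 5 / 2 * K \<le> 15 * K\<^sup>2" using zero_le_square[of K] unfolding power2_eq_square by linarith
    then show ?thesis using R by (intro mult_right_mono) auto
  qed
  finally show ?thesis by (simp add: R_def)
qed

text \<open>
  As \<open>d s \<ge> 1 - s\<close>, every term of the pointwise expansion is dominated by a multiple of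
  \<open>1 / sqrt (1 - s)\<close>, whose integral is \<open>2\<close>.
\<close>

lemma perturbed_integral:
  fixes d e \<rho> n m \<nu> :: "real \<Rightarrow> real"
  assumes \<epsilon>: "0 \<le> \<epsilon>" "\<epsilon> \<le> 1" and K: "K \<ge> 1" "4 * K * \<epsilon> \<le> 1"
    and cont: "continuous_on {0<..<1} d" "continuous_on {0<..<1} e"
      "continuous_on {0<..<1} n" "continuous_on {0<..<1} m"
    and d: "\<And>s. s \<in> {0<..<1} \<Longrightarrow> 1 - s \<le> d s"
    and n: "\<And>s. s \<in> {0<..<1} \<Longrightarrow> \<bar>n s\<bar> \<le> 1" and m: "\<And>s. s \<in> {0<..<1} \<Longrightarrow> \<bar>m s\<bar> \<le> K * \<epsilon>"
    and \<nu>: "\<And>s. s \<in> {0<..<1} \<Longrightarrow> \<bar>\<nu> s\<bar> \<le> K * \<epsilon>\<^sup>2"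
    and e: "\<And>s. s \<in> {0<..<1} \<Longrightarrow> \<bar>e s\<bar> \<le> K * \<epsilon> * d s"
    and \<rho>: "\<And>s. s \<in> {0<..<1} \<Longrightarrow> \<bar>\<rho> s\<bar> \<le> K * \<epsilon>\<^sup>2 * d s"
    and int: "(\<lambda>s. (n s + m s + \<nu> s) / sqrt (d s + e s + \<rho> s)) integrable_on {0..1}"
  defines "M \<equiv> \<lambda>s. n s / sqrt (d s) + m s / sqrt (d s) - n s * e s / (2 * d s * sqrt (d s))"
  shows "M integrable_on {0..1}"
    and "\<bar>integral {0..1} (\<lambda>s. (n s + m s + \<nu> s) / sqrt (d s + e s + \<rho> s)) - integral {0..1} M\<bar>
      \<le> 30 * K\<^sup>2 * \<epsilon>\<^sup>2"
proof -
  have d0: "d s > 0" if "s \<in> {0<..<1}" for s using d[OF that] that by auto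
  have le: "x / sqrt (d s) \<le> x / sqrt (1 - s)" if "s \<in> {0<..<1}" "x \<ge> 0" for x s
    using d[OF that(1)] d0[OF that(1)] that by (intro divide_left_mono) auto
  show intM: "M integrable_on {0..1}"
  proof (rule integrable_of_bound_inverse_sqrt)
    show "continuous_on {0<..<1} M"
      unfolding M_def using d0 by (intro continuous_intros cont) force+
    fix s :: real assume s: "s \<in> {0<..<1}"
    have "\<bar>n s * e s\<bar> \<le> 1 * (K * \<epsilon> * d s)" unfolding abs_mult using n[OF s] e[OF s] by (intro mult_mono) auto
    moreover have "0 \<le> K * \<epsilon> * d s" using \<epsilon> K d0[OF s] by simp
    ultimately have "\<bar>n s * e s\<bar> \<le> K * \<epsilon> * (2 * d s)" by linarith
    then have a: "\<bar>n s * e s / (2 * d s)\<bar> \<le> K * \<epsilon>"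
      using d0[OF s] by (simp add: pos_divide_le_eq)
    have "M s = (n s + m s - n s * e s / (2 * d s)) / sqrt (d s)"
      by (simp add: M_def add_divide_distrib diff_divide_distrib)
    also have "\<bar>\<dots>\<bar> \<le> (1 + K * \<epsilon> + K * \<epsilon>) / sqrt (d s)"
    proof -
      have "\<bar>n s + m s - n s * e s / (2 * d s)\<bar> \<le> 1 + K * \<epsilon> + K * \<epsilon>"
        using n[OF s] m[OF s] a by linarith
      then show ?thesis using d0[OF s] by (simp add: abs_divide divide_right_mono)
    qed
    also have "\<dots> \<le> (1 + K * \<epsilon> + K * \<epsilon>) / sqrt (1 - s)" using \<epsilon> K by (intro le s) auto
    finally show "\<bar>M s\<bar> \<le> (1 + K * \<epsilon> + K * \<epsilon>) / sqrt (1 - s)" .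
  qed
  have "\<bar>integral {0..1} (\<lambda>s. (n s + m s + \<nu> s) / sqrt (d s + e s + \<rho> s) - M s)\<bar> \<le> 2 * (15 * K\<^sup>2 * \<epsilon>\<^sup>2)"
  proof (rule integral_bound_inverse_sqrt)
    show "(\<lambda>s. (n s + m s + \<nu> s) / sqrt (d s + e s + \<rho> s) - M s) integrable_on {0..1}"
      by (intro integrable_diff int intM)
    fix s :: real assume s: "s \<in> {0<..<1}"
    have "\<bar>(n s + m s + \<nu> s) / sqrt (d s + e s + \<rho> s) - M s\<bar> \<le> 15 * K\<^sup>2 * \<epsilon>\<^sup>2 / sqrt (d s)"
      unfolding M_def
      by (rule perturbed_quotient[OF d0[OF s] \<epsilon> K n[OF s] m[OF s] \<nu>[OF s] e[OF s] \<rho>[OF s]])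
    also have "\<dots> \<le> 15 * K\<^sup>2 * \<epsilon>\<^sup>2 / sqrt (1 - s)" by (intro le s) auto
    finally show "\<bar>(n s + m s + \<nu> s) / sqrt (d s + e s + \<rho> s) - M s\<bar> \<le> 15 * K\<^sup>2 * \<epsilon>\<^sup>2 / sqrt (1 - s)" .
  qed
  then show "\<bar>integral {0..1} (\<lambda>s. (n s + m s + \<nu> s) / sqrt (d s + e s + \<rho> s)) - integral {0..1} M\<bar>
      \<le> 30 * K\<^sup>2 * \<epsilon>\<^sup>2"
    using integral_diff[OF int intM] by simp
qed

lemma time_map_scaled:
  assumes \<alpha>: "\<alpha> > 0"
  shows "((\<lambda>s. \<alpha> * (diffusion (\<alpha> * s) / sqrt (potential \<alpha> - potential (\<alpha> * s)))) has_integral time_map \<alpha>) {0..1}"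
proof -
  define f where "f w = diffusion w / sqrt (potential \<alpha> - potential w)" for w
  have "(f has_integral time_map \<alpha>) (cbox 0 \<alpha>)"
    using bif_lambda_eq_time_map(2)[OF \<alpha>] unfolding f_def time_map_def
    by (simp add: has_integral_integrable_integral)
  then have "((\<lambda>s. f (\<alpha> *\<^sub>R s + 0)) has_integral (1 / (\<bar>\<alpha>\<bar> ^ DIM(real))) *\<^sub>R time_map \<alpha>)
     ((\<lambda>x. (1 / \<alpha>) *\<^sub>R x + - ((1 / \<alpha>) *\<^sub>R 0)) ` cbox 0 \<alpha>)"
    using \<alpha> by (intro has_integral_affinity) auto
  moreover have "(\<lambda>x. (1 / \<alpha>) *\<^sub>R x + - ((1 / \<alpha>) *\<^sub>R 0)) ` cbox 0 \<alpha> = {0..1}"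
  proof -
    have "y \<in> (\<lambda>x. x / \<alpha>) ` {0..\<alpha>}" if "y \<in> {0..1}" for y
      using that \<alpha> by (intro image_eqI[of _ _ "\<alpha> * y"]) (auto simp: mult_left_le)
    then have "(\<lambda>x. x / \<alpha>) ` {0..\<alpha>} = {0..1}" using \<alpha> by auto
    then show ?thesis by simp
  qed
  ultimately have "((\<lambda>s. f (\<alpha> * s)) has_integral time_map \<alpha> / \<alpha>) {0..1}" using \<alpha> by simp
  then have "((\<lambda>s. \<alpha> * f (\<alpha> * s)) has_integral \<alpha> * (time_map \<alpha> / \<alpha>)) {0..1}"
    by (rule has_integral_mult_right)
  then show ?thesis using \<alpha> by (simp add: f_def)
qed

lemma difference_le_of_derivative_bound:
  fixes f :: "real \<Rightarrow> real"
  assumes "a \<le> b" and "\<And>x. a \<le> x \<Longrightarrow> x \<le> b \<Longrightarrow> (f has_real_derivative f' x) (at x)"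
    and "\<And>x. a \<le> x \<Longrightarrow> x \<le> b \<Longrightarrow> \<bar>f' x\<bar> \<le> B"
  shows "\<bar>f b - f a\<bar> \<le> B * (b - a)"
proof -
  have "norm (f b - f a) \<le> B * norm (b - a)"
    by (rule field_differentiable_bound[of "{a..b}" f f'])
       (use assms in \<open>auto intro: has_field_derivative_at_within\<close>)
  then show ?thesis using assms(1) by simp
qed

text \<open>
  The normalisations \<open>P\<close> and \<open>q\<close> are to be chosen as the leading orders of the potential and of the
  diffusion at \<open>\<alpha>\<close>, so that numerator and radicand become perturbations of fixed functions of \<open>s\<close>.
\<close>

lemma bif_lambda_scaled:
  assumes \<alpha>: "\<alpha> > 0" and P: "P > 0" and q: "q > 0"
  defines "f \<equiv> \<lambda>s. (diffusion (\<alpha> * s) / q) / sqrt ((potential \<alpha> - potential (\<alpha> * s)) / P)"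
  shows "f integrable_on {0..1}"
    and "bif_lambda \<alpha> = 2 * (\<alpha> * q)\<^sup>2 / P * (integral {0..1} f)\<^sup>2"
proof -
  have "f = (\<lambda>s. (sqrt P / (\<alpha> * q)) * (\<alpha> * (diffusion (\<alpha> * s) / sqrt (potential \<alpha> - potential (\<alpha> * s)))))"
    using \<alpha> by (simp add: f_def real_sqrt_divide fun_eq_iff)
  then have f: "(f has_integral (sqrt P / (\<alpha> * q)) * time_map \<alpha>) {0..1}"
    using has_integral_mult_right[OF time_map_scaled[OF \<alpha>], of "sqrt P / (\<alpha> * q)"] by simp
  then show "f integrable_on {0..1}" by blast
  have "(integral {0..1} f)\<^sup>2 = P / (\<alpha> * q)\<^sup>2 * (time_map \<alpha>)\<^sup>2"
    unfolding integral_unique[OF f] power_mult_distrib power_divide using P by simp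
  then show "bif_lambda \<alpha> = 2 * (\<alpha> * q)\<^sup>2 / P * (integral {0..1} f)\<^sup>2"
    using bif_lambda_eq_time_map(1)[OF \<alpha>] \<alpha> P q by simp
qed


section \<open>The limit of small amplitude\<close>

lemma sin_defect_bounds:
  fixes u :: real
  assumes "u \<ge> 0"
  shows "0 \<le> u - sin u" "u - sin u \<le> u ^ 3"
proof -
  show "0 \<le> u - sin u" using sin_x_le_x[OF assms] by simp
  have "(\<lambda>x. x ^ 3 - (x - sin x)) 0 \<le> (\<lambda>x. x ^ 3 - (x - sin x)) u"
  proof (rule DERIV_nonneg_imp_nondecreasing[OF assms])
    fix x :: real assume "0 \<le> x" "x \<le> u"
    have "\<bar>sin (x / 2)\<bar>\<^sup>2 \<le> \<bar>x / 2\<bar>\<^sup>2" by (intro power_mono abs_sin_x_le_abs_x) auto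
    then have "4 * (sin (x / 2))\<^sup>2 \<le> x\<^sup>2" by (simp add: power_divide)
    moreover have "cos x = 1 - 2 * (sin (x / 2))\<^sup>2" using cos_double_sin[of "x / 2"] by simp
    ultimately have "1 - cos x \<le> 3 * x\<^sup>2" using zero_le_power2[of x] by linarith
    then show "\<exists>y. ((\<lambda>x. x ^ 3 - (x - sin x)) has_real_derivative y) (at x) \<and> 0 \<le> y"
      by (intro exI[of _ "3 * x\<^sup>2 - (1 - cos x)"]) (auto intro!: derivative_eq_intros)
  qed
  then show "u - sin u \<le> u ^ 3" by simp
qed

text \<open>
  With \<open>e = x - sin x\<close>, which is of cubic order, the product of diffusion and reaction differs from
  \<open>2 x\<^sup>2 + 2 x\<^sup>3\<close> by \<open>e\<close> times a factor of order \<open>x\<close>.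
\<close>

lemma potential_near_zero:
  assumes "0 \<le> w" "w \<le> \<alpha>" "\<alpha> \<le> 1"
  shows "\<bar>potential \<alpha> - potential w - (2 / 3 * (\<alpha> ^ 3 - w ^ 3) + (\<alpha> ^ 4 - w ^ 4) / 2)\<bar> \<le> 5 * \<alpha> ^ 4 * (\<alpha> - w)"
proof -
  define h where "h u = potential u - 2 / 3 * u ^ 3 - u ^ 4 / 2" for u
  have "\<bar>h \<alpha> - h w\<bar> \<le> 5 * \<alpha> ^ 4 * (\<alpha> - w)"
  proof (rule difference_le_of_derivative_bound[OF assms(2)])
    fix x assume "w \<le> x" "x \<le> \<alpha>"
    then have x: "0 \<le> x" "x \<le> \<alpha>" "x \<le> 1" using assms by auto
    show "(h has_real_derivative diffusion x * reaction x - 2 * x\<^sup>2 - 2 * x ^ 3) (at x)"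
      unfolding h_def[abs_def] by (auto intro!: derivative_eq_intros has_derivative_potential simp: power2_eq_square power3_eq_cube)
    define e where "e = x - sin x"
    have e: "0 \<le> e" "e \<le> x ^ 3" using sin_defect_bounds[OF x(1)] by (auto simp: e_def)
    have "diffusion x * reaction x - 2 * x\<^sup>2 - 2 * x ^ 3 = e * (e - x\<^sup>2 - 3 * x)"
      unfolding diffusion_def reaction_def e_def by (simp add: power2_eq_square power3_eq_cube algebra_simps)
    also have "\<bar>\<dots>\<bar> \<le> x ^ 3 * (5 * x)"
      unfolding abs_mult
    proof (intro mult_mono)
      have "x ^ 3 \<le> x" "x\<^sup>2 \<le> x"
        using x power_decreasing[of 1 3 x] power_decreasing[of 1 2 x] by auto
      then show "\<bar>e - x\<^sup>2 - 3 * x\<bar> \<le> 5 * x" using e x zero_le_power2[of x] by linarith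
    qed (use e x in auto)
    also have "x ^ 3 * (5 * x) = 5 * x ^ 4" by (simp add: power3_eq_cube power4_eq_xxxx)
    also have "\<dots> \<le> 5 * \<alpha> ^ 4" using x by (simp add: power_mono)
    finally show "\<bar>diffusion x * reaction x - 2 * x\<^sup>2 - 2 * x ^ 3\<bar> \<le> 5 * \<alpha> ^ 4" .
  qed
  also have "h \<alpha> - h w = potential \<alpha> - potential w - (2 / 3 * (\<alpha> ^ 3 - w ^ 3) + (\<alpha> ^ 4 - w ^ 4) / 2)"
    by (simp add: h_def field_simps)
  finally show ?thesis .
qed

lemma one_minus_power_ge:
  fixes s :: real
  assumes "s \<in> {0<..<1}" shows "1 - s \<le> 1 - s ^ 3" "1 - s \<le> 1 - s ^ 4" "1 - s ^ 4 \<le> 4 * (1 - s)"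
proof -
  show "1 - s \<le> 1 - s ^ 3" "1 - s \<le> 1 - s ^ 4"
    using assms power_decreasing[of 1 3 s] power_decreasing[of 1 4 s] by auto
  have "1 - s ^ 4 = (1 + s + s\<^sup>2 + s ^ 3) * (1 - s)"
    by (simp add: power2_eq_square power3_eq_cube power4_eq_xxxx algebra_simps)
  also have "\<dots> \<le> 4 * (1 - s)"
    using assms power_le_one[of s 2] power_le_one[of s 3] by (intro mult_right_mono) auto
  finally show "1 - s ^ 4 \<le> 4 * (1 - s)" .
qed

text \<open>
  An application of \<open>perturbed_integral\<close> with \<open>\<epsilon> = \<alpha>\<close> and \<open>K = 8\<close>; the two numerical constants are
  \<open>1 / (4 * K)\<close> and \<open>30 * K\<^sup>2\<close>.
\<close>

lemma bif_lambda_small: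
  assumes \<alpha>: "0 < \<alpha>" "\<alpha> \<le> 1 / 32"
  shows "\<exists>I. bif_lambda \<alpha> = 3 * \<alpha> * I\<^sup>2 \<and> \<bar>I - (C0 + \<alpha> * C1)\<bar> \<le> 1920 * \<alpha>\<^sup>2"
proof -
  define P where "P = 2 / 3 * \<alpha> ^ 3"
  have P: "P > 0" using \<alpha> by (simp add: P_def)
  define f where "f s = (diffusion (\<alpha> * s) / \<alpha>) / sqrt ((potential \<alpha> - potential (\<alpha> * s)) / P)" for s
  note sc = bif_lambda_scaled[OF \<alpha>(1) P \<alpha>(1), folded f_def]
  define d where "d s = 1 - s ^ 3" for s :: real
  define e where "e s = 3 / 4 * \<alpha> * (1 - s ^ 4)" for s
  define m where "m s = \<alpha> * s\<^sup>2" for s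
  define \<nu> where "\<nu> s = diffusion (\<alpha> * s) / \<alpha> - s - m s" for s
  define \<rho> where "\<rho> s = (potential \<alpha> - potential (\<alpha> * s)) / P - d s - e s" for s
  have f_eq: "f = (\<lambda>s. (s + m s + \<nu> s) / sqrt (d s + e s + \<rho> s))"
    by (simp add: fun_eq_iff f_def \<nu>_def \<rho>_def)
  define M where "M s = s / sqrt (d s) + m s / sqrt (d s) - s * e s / (2 * d s * sqrt (d s))" for s
  have dge: "1 - s \<le> d s" if "s \<in> {0<..<1}" for s
    using one_minus_power_ge(1)[OF that] by (simp add: d_def)
  have bnd\<nu>: "\<bar>\<nu> s\<bar> \<le> 8 * \<alpha>\<^sup>2" if s: "s \<in> {0<..<1}" for s
  proof -
    have "\<nu> s = - ((\<alpha> * s - sin (\<alpha> * s)) / \<alpha>)"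
      using \<alpha> by (simp add: \<nu>_def m_def diffusion_def power2_eq_square field_simps)
    moreover have "0 \<le> \<alpha> * s - sin (\<alpha> * s)" "\<alpha> * s - sin (\<alpha> * s) \<le> (\<alpha> * s) ^ 3"
      using sin_defect_bounds[of "\<alpha> * s"] \<alpha> s by auto
    moreover have "(\<alpha> * s) ^ 3 \<le> \<alpha> ^ 3" using \<alpha> s by (intro power_mono) (auto simp: mult_left_le)
    ultimately have "\<bar>\<nu> s\<bar> \<le> \<alpha> ^ 3 / \<alpha>" using \<alpha> by (simp add: divide_right_mono)
    also have "\<dots> = \<alpha>\<^sup>2" using \<alpha> by (simp add: power3_eq_cube power2_eq_square)
    finally show ?thesis using zero_le_power2[of \<alpha>] by linarith
  qed
  have bnde: "\<bar>e s\<bar> \<le> 8 * \<alpha> * d s" if s: "s \<in> {0<..<1}" for s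
  proof -
    have "0 \<le> 1 - s ^ 4" "1 - s ^ 4 \<le> 4 * d s"
      using one_minus_power_ge(2,3)[OF s] dge[OF s] s by auto
    then have "\<alpha> * (1 - s ^ 4) \<le> \<alpha> * (4 * d s)" "0 \<le> \<alpha> * (1 - s ^ 4)" using \<alpha> by auto
    then show ?thesis unfolding e_def by simp
  qed
  have bnd\<rho>: "\<bar>\<rho> s\<bar> \<le> 8 * \<alpha>\<^sup>2 * d s" if s: "s \<in> {0<..<1}" for s
  proof -
    let ?D = "potential \<alpha> - potential (\<alpha> * s) - (2 / 3 * (\<alpha> ^ 3 - (\<alpha> * s) ^ 3) + (\<alpha> ^ 4 - (\<alpha> * s) ^ 4) / 2)"
    have "P * d s = 2 / 3 * (\<alpha> ^ 3 - (\<alpha> * s) ^ 3)"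
      by (simp add: P_def d_def power_mult_distrib right_diff_distrib)
    moreover have "P * e s = (\<alpha> ^ 4 - (\<alpha> * s) ^ 4) / 2"
      by (simp add: P_def e_def power_mult_distrib power3_eq_cube power4_eq_xxxx right_diff_distrib)
    moreover have "P * \<rho> s = potential \<alpha> - potential (\<alpha> * s) - P * d s - P * e s"
      unfolding \<rho>_def right_diff_distrib[of P] using P by simp
    ultimately have "P * \<rho> s = ?D" by (simp only: diff_diff_eq)
    moreover have "\<bar>?D\<bar> \<le> 5 * \<alpha> ^ 4 * (\<alpha> - \<alpha> * s)"
      using \<alpha> s by (intro potential_near_zero) (auto simp: mult_left_le)
    moreover have "5 * \<alpha> ^ 4 * (\<alpha> - \<alpha> * s) = P * (15 / 2 * \<alpha>\<^sup>2 * (1 - s))"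
      by (simp add: P_def power2_eq_square power3_eq_cube power4_eq_xxxx right_diff_distrib)
    ultimately have "P * \<bar>\<rho> s\<bar> \<le> P * (15 / 2 * \<alpha>\<^sup>2 * (1 - s))"
      using P by (metis abs_mult abs_of_pos)
    then have "\<bar>\<rho> s\<bar> \<le> 15 / 2 * \<alpha>\<^sup>2 * (1 - s)" using P by simp
    also have "\<dots> \<le> 8 * \<alpha>\<^sup>2 * d s" using dge[OF s] s by (intro mult_mono) auto
    finally show ?thesis .
  qed
  have bndm: "\<bar>m s\<bar> \<le> 8 * \<alpha>" if s: "s \<in> {0<..<1}" for s
  proof -
    have "\<alpha> * s\<^sup>2 \<le> \<alpha> * 1" using \<alpha> s by (intro mult_left_mono power_le_one) auto
    then show ?thesis using \<alpha> by (simp add: m_def)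
  qed
  have cont: "continuous_on {0<..<1} d" "continuous_on {0<..<1} e"
      "continuous_on {0<..<1} (\<lambda>s::real. s)" "continuous_on {0<..<1} m"
    unfolding d_def e_def m_def by (intro continuous_intros)+
  have small: "0 \<le> \<alpha>" "\<alpha> \<le> 1" "(1::real) \<le> 8" "4 * 8 * \<alpha> \<le> 1" using \<alpha> by auto
  have bndn: "\<bar>s\<bar> \<le> 1" if "s \<in> {0<..<1}" for s :: real using that by simp
  have M: "M integrable_on {0..1}" "\<bar>integral {0..1} f - integral {0..1} M\<bar> \<le> 30 * 8\<^sup>2 * \<alpha>\<^sup>2"
    by (rule perturbed_integral[where n = "\<lambda>s. s" and d = d and e = e and \<nu> = \<nu> and \<rho> = \<rho> and m = m and K = 8 and \<epsilon> = \<alpha>,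
          folded f_eq M_def];
        (intro small cont sc(1) dge bndn bndm bnd\<nu> bnde bnd\<rho>; assumption))+
  define f0 where "f0 s = s / sqrt (1 - s ^ 3)" for s :: real
  define f1 where "f1 s = 1 / sqrt (1 - s ^ 3) * (s\<^sup>2 - 3 * s * (1 - s ^ 4) / (8 * (1 - s ^ 3)))" for s :: real
  \<comment> \<open>At \<open>s = 1\<close> both sides vanish because all quotients have the value \<open>0\<close> there.\<close>
  have M_eq: "M s = f0 s + \<alpha> * f1 s" if s: "s \<in> {0..1}" for s
  proof (cases "d s = 0")
    case False
    define R where "R = sqrt (d s)"
    have R: "R \<noteq> 0" using False by (simp add: R_def)
    have "M s = s / R + \<alpha> * s\<^sup>2 / R - s * (3 / 4 * \<alpha> * (1 - s ^ 4)) / (2 * d s * R)"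
      by (simp add: M_def m_def e_def R_def)
    moreover have "f0 s = s / R" "f1 s = 1 / R * (s\<^sup>2 - 3 * s * (1 - s ^ 4) / (8 * d s))"
      by (simp_all add: f0_def f1_def R_def d_def)
    ultimately show ?thesis using False R by (simp only:) (simp add: field_simps)
  qed (simp add: M_def f0_def f1_def d_def)
  have f0: "f0 integrable_on {0..1}"
  proof (rule integrable_of_bound_inverse_sqrt[where B = 1])
    show "continuous_on {0<..<1} f0"
      unfolding f0_def using dge unfolding d_def by (intro continuous_intros) force
    fix s :: real assume s: "s \<in> {0<..<1}"
    then show "\<bar>f0 s\<bar> \<le> 1 / sqrt (1 - s)"
      using dge[OF s] unfolding f0_def d_def by (auto simp: abs_divide intro!: frac_le)
  qed
  have "(\<lambda>s. (1 / \<alpha>) * (M s - f0 s)) integrable_on {0..1}"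
    by (intro integrable_on_mult_right integrable_diff M(1) f0)
  then have f1: "f1 integrable_on {0..1}"
    by (rule integrable_eq) (use M_eq \<alpha> in auto)
  have C: "C0 = integral {0..1} f0" "C1 = integral {0..1} f1"
    unfolding C0_def C1_def f0_def[abs_def] f1_def[abs_def] by (rule refl)+
  have "integral {0..1} M = integral {0..1} (\<lambda>s. f0 s + \<alpha> * f1 s)"
    by (intro integral_cong M_eq)
  also have "\<dots> = C0 + \<alpha> * C1"
    using integral_add[OF f0 integrable_on_mult_right[OF f1, of \<alpha>]]
    by (simp only: integral_mult_right C)
  finally have "\<bar>integral {0..1} f - (C0 + \<alpha> * C1)\<bar> \<le> 1920 * \<alpha>\<^sup>2" using M(2) by simp
  moreover have "bif_lambda \<alpha> = 3 * \<alpha> * (integral {0..1} f)\<^sup>2"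
    unfolding sc(2) P_def using \<alpha> by (simp add: power2_eq_square power3_eq_cube)
  ultimately show ?thesis by blast
qed

section \<open>The limit of large amplitude\<close>

text \<open>
  Integrating \<open>u\<^sup>2 sin u\<close> by parts gives \<open>w\<^sup>2 cos w - \<alpha>\<^sup>2 cos \<alpha>\<close> up to lower order. Replacing \<open>w\<^sup>2\<close> by \<open>\<alpha>\<^sup>2\<close> in
  the boundary term costs only \<open>(\<alpha>\<^sup>2 - w\<^sup>2) * \<bar>cos w\<bar>\<close>, which is of the order \<open>\<alpha> (\<alpha> - w)\<close> of the other
  errors.
\<close>

lemma potential_at_infinity:
  assumes "0 \<le> w" "w \<le> \<alpha>" "1 \<le> \<alpha>"
  shows "\<bar>potential \<alpha> - potential w - ((\<alpha> ^ 4 - w ^ 4) / 4 + \<alpha>\<^sup>2 * (cos w - cos \<alpha>))\<bar> \<le> 6 * \<alpha> * (\<alpha> - w)"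
proof -
  define h where "h u = potential u - u ^ 4 / 4 + u\<^sup>2 * cos u" for u
  have "\<bar>h \<alpha> - h w\<bar> \<le> (4 * \<alpha>) * (\<alpha> - w)"
  proof (rule difference_le_of_derivative_bound[OF assms(2)])
    fix x assume "w \<le> x" "x \<le> \<alpha>"
    then have x: "0 \<le> x" "x \<le> \<alpha>" using assms by auto
    have "diffusion x * reaction x - x ^ 3 + (2 * x * cos x - x\<^sup>2 * sin x) = x * sin x + sin x * sin x + 2 * (x * cos x)"
      unfolding diffusion_def reaction_def by (simp add: power2_eq_square power3_eq_cube algebra_simps)
    moreover have "(h has_real_derivative diffusion x * reaction x - x ^ 3 + (2 * x * cos x - x\<^sup>2 * sin x)) (at x)"
      unfolding h_def[abs_def]
      by (auto intro!: derivative_eq_intros has_derivative_potential simp: power3_eq_cube power2_eq_square)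
    ultimately show "(h has_real_derivative x * sin x + sin x * sin x + 2 * (x * cos x)) (at x)" by (simp only:)
    have "\<bar>x * sin x\<bar> \<le> x" "\<bar>x * cos x\<bar> \<le> x" "\<bar>sin x * sin x\<bar> \<le> 1"
      using x mult_mono[of "\<bar>sin x\<bar>" 1 "\<bar>sin x\<bar>" 1] by (auto simp: abs_mult mult_left_le)
    then show "\<bar>x * sin x + sin x * sin x + 2 * (x * cos x)\<bar> \<le> 4 * \<alpha>" using x assms by linarith
  qed
  moreover have "\<bar>(\<alpha>\<^sup>2 - w\<^sup>2) * cos w\<bar> \<le> (2 * \<alpha>) * (\<alpha> - w)"
  proof -
    have "\<bar>(\<alpha>\<^sup>2 - w\<^sup>2) * cos w\<bar> \<le> \<bar>\<alpha>\<^sup>2 - w\<^sup>2\<bar>"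
      unfolding abs_mult by (simp add: mult_left_le)
    also have "\<dots> = (\<alpha> + w) * (\<alpha> - w)"
      using assms by (simp add: power2_eq_square square_diff_square_factored abs_mult)
    also have "\<dots> \<le> (2 * \<alpha>) * (\<alpha> - w)" using assms by (intro mult_right_mono) auto
    finally show ?thesis .
  qed
  moreover have "potential \<alpha> - potential w - ((\<alpha> ^ 4 - w ^ 4) / 4 + \<alpha>\<^sup>2 * (cos w - cos \<alpha>))
     = (h \<alpha> - h w) - (\<alpha>\<^sup>2 - w\<^sup>2) * cos w"
    by (simp add: h_def field_simps)
  moreover have "(4 * \<alpha>) * (\<alpha> - w) + (2 * \<alpha>) * (\<alpha> - w) = 6 * \<alpha> * (\<alpha> - w)" by (simp add: algebra_simps)
  ultimately show ?thesis by linarith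
qed

lemma abs_cos_diff_le: "\<bar>cos x - cos y\<bar> \<le> \<bar>x - y\<bar>" for x y :: real
proof (induction x y rule: linorder_wlog)
  case (le x y)
  have "\<bar>cos y - cos x\<bar> \<le> 1 * (y - x)"
    by (rule difference_le_of_derivative_bound[OF le, of _ "\<lambda>t. - sin t"])
       (auto intro!: derivative_eq_intros)
  then show ?case using le by (simp add: abs_minus_commute[of "cos x"] abs_minus_commute[of x])
qed (simp add: abs_minus_commute)

text \<open>
  Since \<open>1 - s\<^sup>4 = (1 - s) q\<close> with \<open>q = 4\<close> at \<open>s = 1\<close>, the two kernels have the same leading singularity,
  and their difference is smaller by a factor \<open>1 - s\<close>.
\<close>

lemma quartic_kernel_singularity:
  fixes s :: real
  assumes s: "s \<in> {0<..<1}"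
  shows "\<bar>s\<^sup>2 / ((1 - s ^ 4) * sqrt (1 - s ^ 4)) - 1 / (8 * ((1 - s) * sqrt (1 - s)))\<bar> \<le> 5 / sqrt (1 - s)"
proof -
  define y where "y = 1 - s"
  define q where "q = (1 + s) * (1 + s\<^sup>2)"
  define w where "w = sqrt q"
  have y: "y > 0" "y < 1" using s by (auto simp: y_def)
  have s2: "s\<^sup>2 \<le> 1" "s ^ 3 \<le> 1" "0 \<le> s\<^sup>2" "0 \<le> s ^ 3" using s by (auto simp: power_le_one)
  have qexp: "q = 1 + s + s\<^sup>2 + s ^ 3"
    by (simp add: q_def power2_eq_square power3_eq_cube algebra_simps)
  have q: "1 \<le> q" "q \<le> 4" using qexp s s2 by auto
  have q4: "4 - q \<le> 6 * y"
  proof -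
    have "4 - q = (3 + 2 * s + s\<^sup>2) * y"
      by (simp add: qexp y_def power2_eq_square power3_eq_cube algebra_simps)
    also have "\<dots> \<le> 6 * y" using s s2 y by (intro mult_right_mono) auto
    finally show ?thesis .
  qed
  have w: "1 \<le> w" "w \<le> 2" "w * w = q"
    using q real_sqrt_le_mono[of q 4] by (auto simp: w_def)
  have fact: "1 - s ^ 4 = y * q"
    by (simp add: y_def qexp power2_eq_square power3_eq_cube power4_eq_xxxx algebra_simps)
  have sq: "sqrt (1 - s ^ 4) = sqrt y * w" by (simp add: fact w_def real_sqrt_mult)
  have w2: "2 - w \<le> 2 * y"
  proof -
    have "(2 - w) * 3 \<le> (2 - w) * (2 + w)" using w by (intro mult_left_mono) auto
    also have "\<dots> = 4 - q" using w(3) by (simp add: algebra_simps)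
    finally have "(2 - w) * 3 \<le> 6 * y" using q4 by (rule order_trans)
    then show ?thesis by simp
  qed
  have w3: "8 - w ^ 3 \<le> 24 * y" "w ^ 3 \<le> 8" "1 \<le> w ^ 3"
  proof -
    have "8 - w ^ 3 = (2 - w) * (4 + 2 * w + q)"
      unfolding w(3)[symmetric] by (simp add: power3_eq_cube algebra_simps)
    also have "\<dots> \<le> (2 * y) * 12" using w w2 q by (intro mult_mono) auto
    finally show "8 - w ^ 3 \<le> 24 * y" by simp
    show "w ^ 3 \<le> 8" using power_mono[of w 2 3] w by simp
    show "1 \<le> w ^ 3" using w by (simp add: one_le_power)
  qed
  have "1 - s\<^sup>2 \<le> 2 * y"
  proof -
    have "1 - s\<^sup>2 = (1 + s) * y" by (simp add: y_def power2_eq_square algebra_simps)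
    also have "\<dots> \<le> 2 * y" using s y by (intro mult_right_mono) auto
    finally show ?thesis .
  qed
  then have num: "\<bar>8 * s\<^sup>2 - w ^ 3\<bar> \<le> 40 * y" using w3 s2 y by linarith
  have "s\<^sup>2 / w ^ 3 - 1 / 8 = (8 * s\<^sup>2 - w ^ 3) / (8 * w ^ 3)" using w by (simp add: field_simps)
  also have "\<bar>\<dots>\<bar> \<le> 40 * y / 8"
    unfolding abs_divide using num w3 y by (intro frac_le) auto
  finally have main: "\<bar>s\<^sup>2 / w ^ 3 - 1 / 8\<bar> \<le> 5 * y" by simp
  have "s\<^sup>2 / ((1 - s ^ 4) * sqrt (1 - s ^ 4)) = s\<^sup>2 / w ^ 3 / (y * sqrt y)"
    unfolding sq unfolding fact w(3)[symmetric] power3_eq_cube by (simp add: mult_ac)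
  moreover have "1 / (8 * ((1 - s) * sqrt (1 - s))) = 1 / 8 / (y * sqrt y)" by (simp add: y_def)
  ultimately have "s\<^sup>2 / ((1 - s ^ 4) * sqrt (1 - s ^ 4)) - 1 / (8 * ((1 - s) * sqrt (1 - s)))
      = (s\<^sup>2 / w ^ 3 - 1 / 8) / (y * sqrt y)"
    by (simp add: diff_divide_distrib)
  also have "\<bar>\<dots>\<bar> \<le> (5 * y) / (y * sqrt y)"
  proof -
    have pos: "y * sqrt y > 0" using y by simp
    show ?thesis unfolding abs_divide abs_of_pos[OF pos] using main pos by (intro divide_right_mono) auto
  qed
  also have "\<dots> = 5 / sqrt (1 - s)" using y unfolding y_def[symmetric] by simp
  finally show ?thesis .
qed

text \<open>
  An application of \<open>perturbed_integral\<close> with \<open>\<epsilon> = 1 / \<alpha>\<close> and \<open>K = 24\<close>, whence the threshold \<open>96 = 4 * K\<close>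
  and the part \<open>17280 = 30 * K\<^sup>2\<close> of the constant. The remaining \<open>42\<close> comes from the first-order term:
  the integral of \<open>g\<close> is within \<open>20\<close> of \<open>1 / 8\<close> of that of \<open>k\<close>, which in turn is within \<open>4\<close> of its
  leading term, and \<open>g\<close> enters with the factor \<open>2 / \<alpha>\<^sup>2\<close>.
\<close>

lemma bif_lambda_large:
  assumes \<alpha>: "\<alpha> \<ge> 96"
  shows "\<exists>I. bif_lambda \<alpha> = 8 * \<alpha>\<^sup>2 * I\<^sup>2 \<and>
     \<bar>I - (A22 - sqrt pi / 2 * (1 / (\<alpha> * sqrt \<alpha>)) * sin (\<alpha> - pi / 4))\<bar> \<le> 17322 / \<alpha>\<^sup>2"
proof -
  define P where "P = \<alpha> ^ 4 / 4"
  have a0: "\<alpha> > 0" using \<alpha> by simp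
  have P: "P > 0" using a0 by (simp add: P_def)
  have q: "\<alpha>\<^sup>2 > 0" using a0 by simp
  define f where "f s = (diffusion (\<alpha> * s) / \<alpha>\<^sup>2) / sqrt ((potential \<alpha> - potential (\<alpha> * s)) / P)" for s
  note sc = bif_lambda_scaled[OF a0 P q, folded f_def]
  define d where "d s = 1 - s ^ 4" for s :: real
  define e where "e s = 4 / \<alpha>\<^sup>2 * (cos (\<alpha> * s) - cos \<alpha>)" for s
  define \<nu> where "\<nu> s = diffusion (\<alpha> * s) / \<alpha>\<^sup>2 - s\<^sup>2" for s
  define \<rho> where "\<rho> s = (potential \<alpha> - potential (\<alpha> * s)) / P - d s - e s" for s
  have f_eq: "f = (\<lambda>s. (s\<^sup>2 + 0 + \<nu> s) / sqrt (d s + e s + \<rho> s))"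
    by (simp add: fun_eq_iff f_def \<nu>_def \<rho>_def)
  define M where "M s = s\<^sup>2 / sqrt (d s) + 0 / sqrt (d s) - s\<^sup>2 * e s / (2 * d s * sqrt (d s))" for s
  have dge: "1 - s \<le> d s" if "s \<in> {0<..<1}" for s
    using one_minus_power_ge(2)[OF that] by (simp add: d_def)
  have bnd\<nu>: "\<bar>\<nu> s\<bar> \<le> 24 * (1 / \<alpha>)\<^sup>2" for s
  proof -
    have "\<nu> s = sin (\<alpha> * s) / \<alpha>\<^sup>2"
      using a0 by (simp add: \<nu>_def diffusion_def power_mult_distrib add_divide_distrib)
    then have "\<bar>\<nu> s\<bar> \<le> 1 / \<alpha>\<^sup>2" using q by (simp add: abs_divide divide_right_mono)
    then show ?thesis using q by (simp add: power_divide divide_simps)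
  qed
  have bnde: "\<bar>e s\<bar> \<le> 24 * (1 / \<alpha>) * d s" if s: "s \<in> {0<..<1}" for s
  proof -
    have "\<bar>cos (\<alpha> * s) - cos \<alpha>\<bar> \<le> \<bar>\<alpha> * s - \<alpha>\<bar>" by (rule abs_cos_diff_le)
    also have "\<dots> = \<alpha> * (1 - s)" using a0 s by (simp add: abs_if right_diff_distrib)
    finally have "\<bar>e s\<bar> \<le> 4 / \<alpha>\<^sup>2 * (\<alpha> * (1 - s))"
      unfolding e_def abs_mult by (simp add: mult_left_mono divide_right_mono)
    also have "\<dots> = 4 * (1 / \<alpha>) * (1 - s)" using a0 by (simp add: power2_eq_square)
    also have "\<dots> \<le> 24 * (1 / \<alpha>) * d s" using a0 dge[OF s] s by (intro mult_mono) (auto simp: divide_right_mono)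
    finally show ?thesis .
  qed
  have bnd\<rho>: "\<bar>\<rho> s\<bar> \<le> 24 * (1 / \<alpha>)\<^sup>2 * d s" if s: "s \<in> {0<..<1}" for s
  proof -
    let ?D = "potential \<alpha> - potential (\<alpha> * s) - ((\<alpha> ^ 4 - (\<alpha> * s) ^ 4) / 4 + \<alpha>\<^sup>2 * (cos (\<alpha> * s) - cos \<alpha>))"
    have "P * d s = (\<alpha> ^ 4 - (\<alpha> * s) ^ 4) / 4"
      by (simp add: P_def d_def power_mult_distrib right_diff_distrib)
    moreover have "P * e s = \<alpha>\<^sup>2 * (cos (\<alpha> * s) - cos \<alpha>)"
      using a0 by (simp add: P_def e_def power2_eq_square power4_eq_xxxx)
    moreover have "P * \<rho> s = potential \<alpha> - potential (\<alpha> * s) - P * d s - P * e s"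
      unfolding \<rho>_def right_diff_distrib[of P] using P by simp
    ultimately have "P * \<rho> s = ?D" by (simp only: diff_diff_eq)
    moreover have "\<bar>?D\<bar> \<le> 6 * \<alpha> * (\<alpha> - \<alpha> * s)"
      using \<alpha> s by (intro potential_at_infinity) (auto simp: mult_left_le)
    moreover have "6 * \<alpha> * (\<alpha> - \<alpha> * s) = P * (24 * (1 / \<alpha>)\<^sup>2 * (1 - s))"
      using a0 by (simp add: P_def power2_eq_square power4_eq_xxxx right_diff_distrib)
    ultimately have "P * \<bar>\<rho> s\<bar> \<le> P * (24 * (1 / \<alpha>)\<^sup>2 * (1 - s))"
      using P by (metis abs_mult abs_of_pos)
    then have "\<bar>\<rho> s\<bar> \<le> 24 * (1 / \<alpha>)\<^sup>2 * (1 - s)" using P by simp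
    also have "\<dots> \<le> 24 * (1 / \<alpha>)\<^sup>2 * d s" using dge[OF s] by (intro mult_left_mono) auto
    finally show ?thesis .
  qed
  have bndn: "\<bar>s\<^sup>2\<bar> \<le> 1" if "s \<in> {0<..<1}" for s :: real using that by (simp add: power_le_one)
  have bndm: "\<bar>0::real\<bar> \<le> 24 * (1 / \<alpha>)" using a0 by simp
  have cont: "continuous_on {0<..<1} d" "continuous_on {0<..<1} e"
      "continuous_on {0<..<1} (\<lambda>s::real. s\<^sup>2)" "continuous_on {0<..<1} (\<lambda>s::real. 0::real)"
    unfolding d_def e_def by (intro continuous_intros)+
  have small: "0 \<le> 1 / \<alpha>" "1 / \<alpha> \<le> 1" "(1::real) \<le> 24" "4 * 24 * (1 / \<alpha>) \<le> 1" using \<alpha> by auto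
  have M: "M integrable_on {0..1}" "\<bar>integral {0..1} f - integral {0..1} M\<bar> \<le> 30 * 24\<^sup>2 * (1 / \<alpha>)\<^sup>2"
    by (rule perturbed_integral[where n = "\<lambda>s. s\<^sup>2" and d = d and e = e and \<nu> = \<nu> and \<rho> = \<rho> and m = "\<lambda>s. 0" and K = 24 and \<epsilon> = "1 / \<alpha>",
          folded f_eq M_def];
        (intro small cont sc(1) dge bndn bndm bnd\<nu> bnde bnd\<rho>; assumption))+
  define f0 where "f0 s = s\<^sup>2 / sqrt (1 - s ^ 4)" for s :: real
  define g where "g s = s\<^sup>2 * (cos (\<alpha> * s) - cos \<alpha>) / ((1 - s ^ 4) * sqrt (1 - s ^ 4))" for s :: real
  define k where "k s = (cos (\<alpha> * s) - cos \<alpha>) / ((1 - s) * sqrt (1 - s))" for s :: real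
  have M_eq: "M s = f0 s - 2 / \<alpha>\<^sup>2 * g s" for s
  proof (cases "d s = 0")
    case False
    define R where "R = sqrt (d s)"
    have R: "R \<noteq> 0" using False by (simp add: R_def)
    have "M s = s\<^sup>2 / R - s\<^sup>2 * (4 / \<alpha>\<^sup>2 * (cos (\<alpha> * s) - cos \<alpha>)) / (2 * d s * R)"
      by (simp add: M_def e_def R_def)
    moreover have "f0 s = s\<^sup>2 / R" "g s = s\<^sup>2 * (cos (\<alpha> * s) - cos \<alpha>) / (d s * R)"
      by (simp_all add: f0_def g_def R_def d_def)
    ultimately show ?thesis using a0 False R by (simp only:) (simp add: field_simps)
  qed (simp add: M_def f0_def g_def d_def)
  have f0: "f0 integrable_on {0..1}"
  proof (rule integrable_of_bound_inverse_sqrt[where B = 1])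
    show "continuous_on {0<..<1} f0"
      unfolding f0_def using dge unfolding d_def by (intro continuous_intros) force
    fix s :: real assume s: "s \<in> {0<..<1}"
    then show "\<bar>f0 s\<bar> \<le> 1 / sqrt (1 - s)"
      using dge[OF s] unfolding f0_def d_def by (auto simp: abs_divide power_le_one intro!: frac_le)
  qed
  have "(\<lambda>s. (\<alpha>\<^sup>2 / 2) * (f0 s - M s)) integrable_on {0..1}"
    by (intro integrable_on_mult_right integrable_diff M(1) f0)
  then have g: "g integrable_on {0..1}"
    by (rule integrable_eq) (use M_eq q in auto)
  have A: "A22 = integral {0..1} f0" unfolding A22_def f0_def[abs_def] by (rule refl)
  have intM: "integral {0..1} M = A22 - 2 / \<alpha>\<^sup>2 * integral {0..1} g"
    using integral_diff[OF f0 integrable_on_mult_right[OF g, of "2 / \<alpha>\<^sup>2"]]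
    by (simp only: integral_mult_right A M_eq[abs_def])
  note osc = oscillatory_integral[OF a0, folded k_def]
  have "\<bar>integral {0..1} (\<lambda>s. g s - 1 / 8 * k s)\<bar> \<le> 2 * 10"
  proof (rule integral_bound_inverse_sqrt)
    show "(\<lambda>s. g s - 1 / 8 * k s) integrable_on {0..1}"
      by (intro integrable_diff g integrable_on_mult_right osc(1))
    fix s :: real assume s: "s \<in> {0<..<1}"
    have "\<bar>cos (\<alpha> * s) - cos \<alpha>\<bar> \<le> 2"
      using abs_cos_le_one[of "\<alpha> * s"] abs_cos_le_one[of \<alpha>] by linarith
    then have "\<bar>cos (\<alpha> * s) - cos \<alpha>\<bar> *
       \<bar>s\<^sup>2 / ((1 - s ^ 4) * sqrt (1 - s ^ 4)) - 1 / (8 * ((1 - s) * sqrt (1 - s)))\<bar> \<le> 2 * (5 / sqrt (1 - s))"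
      using quartic_kernel_singularity[OF s] by (intro mult_mono) auto
    moreover have "g s - 1 / 8 * k s = (cos (\<alpha> * s) - cos \<alpha>) *
       (s\<^sup>2 / ((1 - s ^ 4) * sqrt (1 - s ^ 4)) - 1 / (8 * ((1 - s) * sqrt (1 - s))))"
      unfolding g_def k_def by (simp add: right_diff_distrib[of "cos (\<alpha> * s) - cos \<alpha>"] mult.commute[of "s\<^sup>2"])
    ultimately show "\<bar>g s - 1 / 8 * k s\<bar> \<le> 10 / sqrt (1 - s)" by (simp only: abs_mult)
  qed
  then have "\<bar>integral {0..1} g - 1 / 8 * integral {0..1} k\<bar> \<le> 20"
    using integral_diff[OF g integrable_on_mult_right[OF osc(1), of "1 / 8"]] by simp
  then have "\<bar>integral {0..1} g - sqrt pi * sqrt \<alpha> * sin (\<alpha> - pi / 4) / 4\<bar> \<le> 21"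
    using osc(2) by linarith
  then have "2 / \<alpha>\<^sup>2 * \<bar>integral {0..1} g - sqrt pi * sqrt \<alpha> * sin (\<alpha> - pi / 4) / 4\<bar> \<le> 2 / \<alpha>\<^sup>2 * 21"
    using q by (intro mult_left_mono) auto
  then have "\<bar>2 / \<alpha>\<^sup>2 * integral {0..1} g - 2 / \<alpha>\<^sup>2 * (sqrt pi * sqrt \<alpha> * sin (\<alpha> - pi / 4) / 4)\<bar> \<le> 42 / \<alpha>\<^sup>2"
    unfolding right_diff_distrib[symmetric] abs_mult using q by simp
  moreover have "2 / \<alpha>\<^sup>2 * (sqrt pi * sqrt \<alpha> * sin (\<alpha> - pi / 4) / 4)
     = sqrt pi / 2 * (1 / (\<alpha> * sqrt \<alpha>)) * sin (\<alpha> - pi / 4)"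
  proof -
    have "sqrt \<alpha> / \<alpha>\<^sup>2 = 1 / (\<alpha> * sqrt \<alpha>)"
      using a0 by (simp add: field_simps power2_eq_square)
    moreover have "2 / \<alpha>\<^sup>2 * (sqrt pi * sqrt \<alpha> * sin (\<alpha> - pi / 4) / 4)
        = sqrt pi / 2 * (sqrt \<alpha> / \<alpha>\<^sup>2) * sin (\<alpha> - pi / 4)" by simp
    ultimately show ?thesis by (simp only:)
  qed
  moreover have "30 * 24\<^sup>2 * (1 / \<alpha>)\<^sup>2 = 17280 / \<alpha>\<^sup>2" by (simp add: power_divide)
  moreover have "17280 / \<alpha>\<^sup>2 + 42 / \<alpha>\<^sup>2 = 17322 / \<alpha>\<^sup>2" by (simp add: add_divide_distrib[symmetric])
  ultimately have "\<bar>integral {0..1} f - (A22 - sqrt pi / 2 * (1 / (\<alpha> * sqrt \<alpha>)) * sin (\<alpha> - pi / 4))\<bar> \<le> 17322 / \<alpha>\<^sup>2"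
    using M(2) intM by linarith
  moreover have "bif_lambda \<alpha> = 8 * \<alpha>\<^sup>2 * (integral {0..1} f)\<^sup>2"
    unfolding sc(2) P_def using a0 by (simp add: power2_eq_square power4_eq_xxxx)
  ultimately show ?thesis by blast
qed

text \<open>
  Each remainder is defined by the identity that it has to satisfy, and is estimated by squaring the
  expansion of the scaled time map.
\<close>

theorem theorem1p3:
  shows "(\<exists>r. r \<in> o[at_top](\<lambda>\<alpha>::real. \<alpha> powr (-3/2)) \<and>
           (\<forall>\<alpha>>0. bif_lambda \<alpha> =
              8 * \<alpha>\<^sup>2 * (A22\<^sup>2 - A22 * sqrt pi * \<alpha> powr (-3/2) * sin (\<alpha> - pi / 4) + r \<alpha>))) \<and>
         (\<exists>r. r \<in> O[at_right 0](\<lambda>\<alpha>::real. \<alpha>\<^sup>2) \<and>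
           (\<forall>\<alpha>>0. bif_lambda \<alpha> =
              3 * \<alpha> * (C0\<^sup>2 + 2 * C0 * C1 * \<alpha> + r \<alpha>)))"
proof (intro conjI)
  define r where "r \<alpha> = bif_lambda \<alpha> / (8 * \<alpha>\<^sup>2) - (A22\<^sup>2 - A22 * sqrt pi * \<alpha> powr (-3/2) * sin (\<alpha> - pi / 4))" for \<alpha>
  define B where "B = 17322 * (2 * \<bar>A22\<bar> + 17324) + 1"
  have bnd: "\<bar>r \<alpha>\<bar> \<le> B * (1 / \<alpha>\<^sup>2)" if \<alpha>: "\<alpha> \<ge> 96" for \<alpha>
  proof -
    obtain I where I: "bif_lambda \<alpha> = 8 * \<alpha>\<^sup>2 * I\<^sup>2"
      and err: "\<bar>I - (A22 - sqrt pi / 2 * (1 / (\<alpha> * sqrt \<alpha>)) * sin (\<alpha> - pi / 4))\<bar> \<le> 17322 / \<alpha>\<^sup>2"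
      using bif_lambda_large[OF \<alpha>] by blast
    define b where "b = - (sqrt pi / 2 * (1 / (\<alpha> * sqrt \<alpha>)) * sin (\<alpha> - pi / 4))"
    define \<delta> where "\<delta> = I - (A22 + b)"
    have a0: "\<alpha> > 0" using \<alpha> by simp
    have "\<alpha> powr (-3/2) = 1 / (\<alpha> powr (1 + 1/2))" by (simp add: powr_minus_divide[symmetric])
    also have "\<alpha> powr (1 + 1/2) = \<alpha> * sqrt \<alpha>" using a0 by (simp only: powr_add powr_half_sqrt) simp
    finally have pw: "\<alpha> powr (-3/2) = 1 / (\<alpha> * sqrt \<alpha>)" .
    have \<delta>: "\<bar>\<delta>\<bar> \<le> 17322 * (1 / \<alpha>\<^sup>2)" using err by (simp add: \<delta>_def b_def)
    have le1: "1 / \<alpha> \<le> 1" "1 / \<alpha>\<^sup>2 \<le> 1" using \<alpha> by (auto simp: divide_simps one_le_power)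
    have \<delta>1: "\<bar>\<delta>\<bar> \<le> 17322" using \<delta> le1 by linarith
    have b: "\<bar>b\<bar> \<le> 1 / (\<alpha> * sqrt \<alpha>)"
    proof -
      have "sqrt pi \<le> 2" using real_sqrt_le_mono[of pi 4] pi_less_4 by simp
      then have "(sqrt pi / 2 * (1 / (\<alpha> * sqrt \<alpha>))) * \<bar>sin (\<alpha> - pi / 4)\<bar> \<le> (1 * (1 / (\<alpha> * sqrt \<alpha>))) * 1"
        using a0 by (intro mult_mono) auto
      then show ?thesis using a0 by (simp add: b_def abs_mult)
    qed
    have b2: "b\<^sup>2 \<le> 1 / \<alpha>\<^sup>2"
    proof -
      have "\<bar>b\<bar>\<^sup>2 \<le> (1 / (\<alpha> * sqrt \<alpha>))\<^sup>2" using b by (intro power_mono) auto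
      also have "\<dots> = 1 / \<alpha>\<^sup>2 * (1 / \<alpha>)" using a0 by (simp add: power_divide power_mult_distrib)
      also have "\<dots> \<le> 1 / \<alpha>\<^sup>2 * 1" using le1 by (intro mult_left_mono) auto
      finally show ?thesis by simp
    qed
    have b1: "\<bar>b\<bar> \<le> 1"
    proof -
      have "b\<^sup>2 \<le> 1" using b2 le1 by linarith
      then show ?thesis by (simp add: abs_square_le_1)
    qed
    have "r \<alpha> = I\<^sup>2 - (A22\<^sup>2 + 2 * A22 * b)"
      unfolding r_def pw I b_def using a0 by (simp add: field_simps)
    also have "\<dots> = \<delta> * (2 * A22 + 2 * b + \<delta>) + b\<^sup>2"
      by (simp add: \<delta>_def power2_eq_square algebra_simps)
    finally have "\<bar>r \<alpha>\<bar> \<le> \<bar>\<delta>\<bar> * \<bar>2 * A22 + 2 * b + \<delta>\<bar> + b\<^sup>2"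
      by (metis abs_mult abs_power2 abs_triangle_ineq)
    also have "\<dots> \<le> 17322 * (1 / \<alpha>\<^sup>2) * (2 * \<bar>A22\<bar> + 17324) + 1 / \<alpha>\<^sup>2"
    proof (intro add_mono mult_mono \<delta> b2)
      show "\<bar>2 * A22 + 2 * b + \<delta>\<bar> \<le> 2 * \<bar>A22\<bar> + 17324" using b1 \<delta>1 by linarith
    qed auto
    also have "\<dots> = B * (1 / \<alpha>\<^sup>2)" unfolding B_def by (simp add: algebra_simps)
    finally show ?thesis .
  qed
  have "r \<in> O[at_top](\<lambda>\<alpha>. 1 / \<alpha>\<^sup>2)"
  proof (rule bigoI[where c = B])
    show "\<forall>\<^sub>F \<alpha> in at_top. norm (r \<alpha>) \<le> B * norm (1 / \<alpha>\<^sup>2)"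
      using eventually_ge_at_top[of 96] by eventually_elim (use bnd in simp)
  qed
  also have "(\<lambda>\<alpha>::real. 1 / \<alpha>\<^sup>2) \<in> o[at_top](\<lambda>\<alpha>. \<alpha> powr (-3/2))" by real_asymp
  finally have "r \<in> o[at_top](\<lambda>\<alpha>. \<alpha> powr (-3/2))" .
  moreover have "\<forall>\<alpha>>0. bif_lambda \<alpha> =
      8 * \<alpha>\<^sup>2 * (A22\<^sup>2 - A22 * sqrt pi * \<alpha> powr (-3/2) * sin (\<alpha> - pi / 4) + r \<alpha>)"
    by (simp add: r_def)
  ultimately show "\<exists>r. r \<in> o[at_top](\<lambda>\<alpha>::real. \<alpha> powr (-3/2)) \<and>
           (\<forall>\<alpha>>0. bif_lambda \<alpha> =
              8 * \<alpha>\<^sup>2 * (A22\<^sup>2 - A22 * sqrt pi * \<alpha> powr (-3/2) * sin (\<alpha> - pi / 4) + r \<alpha>))" by blast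
next
  define r where "r \<alpha> = bif_lambda \<alpha> / (3 * \<alpha>) - (C0\<^sup>2 + 2 * C0 * C1 * \<alpha>)" for \<alpha>
  define B where "B = 1920 * (2 * \<bar>C0\<bar> + 2 * \<bar>C1\<bar> + 1920) + C1\<^sup>2"
  have bnd: "\<bar>r \<alpha>\<bar> \<le> B * \<alpha>\<^sup>2" if \<alpha>: "0 < \<alpha>" "\<alpha> \<le> 1 / 32" for \<alpha>
  proof -
    obtain I where I: "bif_lambda \<alpha> = 3 * \<alpha> * I\<^sup>2" and err: "\<bar>I - (C0 + \<alpha> * C1)\<bar> \<le> 1920 * \<alpha>\<^sup>2"
      using bif_lambda_small[OF \<alpha>] by blast
    define \<delta> where "\<delta> = I - (C0 + \<alpha> * C1)"
    have \<delta>: "\<bar>\<delta>\<bar> \<le> 1920 * \<alpha>\<^sup>2" using err by (simp add: \<delta>_def)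
    have "\<alpha>\<^sup>2 \<le> 1" using \<alpha> by (simp add: power_le_one)
    then have \<delta>1: "\<bar>\<delta>\<bar> \<le> 1920" using \<delta> by linarith
    have ac: "\<bar>\<alpha> * C1\<bar> \<le> \<bar>C1\<bar>" using \<alpha> by (simp add: abs_mult mult_left_le_one_le)
    have "r \<alpha> = I\<^sup>2 - (C0\<^sup>2 + 2 * C0 * C1 * \<alpha>)" unfolding r_def I using \<alpha> by simp
    also have "\<dots> = \<delta> * (2 * C0 + 2 * (\<alpha> * C1) + \<delta>) + C1\<^sup>2 * \<alpha>\<^sup>2"
      by (simp add: \<delta>_def power2_eq_square algebra_simps)
    finally have "\<bar>r \<alpha>\<bar> \<le> \<bar>\<delta>\<bar> * \<bar>2 * C0 + 2 * (\<alpha> * C1) + \<delta>\<bar> + C1\<^sup>2 * \<alpha>\<^sup>2"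
      by (metis abs_mult abs_power2 abs_triangle_ineq power_mult_distrib)
    also have "\<dots> \<le> (1920 * \<alpha>\<^sup>2) * (2 * \<bar>C0\<bar> + 2 * \<bar>C1\<bar> + 1920) + C1\<^sup>2 * \<alpha>\<^sup>2"
    proof (intro add_mono mult_mono \<delta> order_refl)
      show "\<bar>2 * C0 + 2 * (\<alpha> * C1) + \<delta>\<bar> \<le> 2 * \<bar>C0\<bar> + 2 * \<bar>C1\<bar> + 1920" using ac \<delta>1 by linarith
    qed auto
    also have "\<dots> = B * \<alpha>\<^sup>2" unfolding B_def by (simp add: algebra_simps)
    finally show ?thesis .
  qed
  have "r \<in> O[at_right 0](\<lambda>\<alpha>::real. \<alpha>\<^sup>2)"
  proof (rule bigoI[where c = B])
    have "\<forall>\<^sub>F \<alpha>::real in at_right 0. \<alpha> \<in> {0<..<1 / 32}" by (rule eventually_at_right_real) simp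
    then show "\<forall>\<^sub>F \<alpha> in at_right 0. norm (r \<alpha>) \<le> B * norm (\<alpha>\<^sup>2)"
      by eventually_elim (use bnd in simp)
  qed
  moreover have "\<forall>\<alpha>>0. bif_lambda \<alpha> = 3 * \<alpha> * (C0\<^sup>2 + 2 * C0 * C1 * \<alpha> + r \<alpha>)"
    by (simp add: r_def)
  ultimately show "\<exists>r. r \<in> O[at_right 0](\<lambda>\<alpha>::real. \<alpha>\<^sup>2) \<and>
           (\<forall>\<alpha>>0. bif_lambda \<alpha> = 3 * \<alpha> * (C0\<^sup>2 + 2 * C0 * C1 * \<alpha> + r \<alpha>))" by blast
qed


end
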